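(* Let $n\ge 1$ and let $G$ be a graph on $n$ vertices with walk-matrix $W$ such that $\det(W)\neq 0$ and $\frac{\det(W)}{2^{\lfloor n/2\rfloor}}$ is an odd square-free integer (that is, $G\in\mathcal{F}_n$). Then $G$ is determined by its generalized spectrum (DGS).
   Context: All graphs are finite and simple. For a graph $G$ on $n$ vertices, $A=A(G)$ is its $(0,1)$-adjacency matrix, and the spectrum of $G$ is the multiset of eigenvalues of $A(G)$. The generalized spectrum of $G$ is the spectrum of $G$ together with the spectrum of its complement. $G$ is determined by its generalized spectrum (DGS) if every graph $H$ that is cospectral with $G$ and whose complement is cospectral with the complement of $G$ is isomorphic to $G$. The walk-matrix of $G$ is the $n\times n$ matrix $W=[e,Ae,A^2e,\dots,A^{n-1}e]$, where $e$ is the all-one column vector. $\mathcal{F}_n$ denotes the set of graphs $G$ on $n$ vertices with $\det(W)\ne 0$ such that $\det(W)/2^{\lfloor n/2\rfloor}$ is an odd square-free integer. *)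

theory Defs
  imports
    "Graph_Theory.Digraph_Isomorphism"
    "Graph_Theory.Pair_Digraph"
    "Jordan_Normal_Form.Char_Poly"
    "HOL-Computational_Algebra.Squarefree"
begin

text \<open>
  A finite simple graph is a \<^locale>\<open>pair_graph\<close>: a finite symmetric loop-free digraph without
  parallel arcs, each edge being represented by its two arcs. The vertices are labelled by
  \<open>0, \<dots>, n - 1\<close>, so that they can index the rows and columns of matrices.
\<close>

definition graph_on :: "nat \<Rightarrow> nat pair_pre_digraph \<Rightarrow> bool" where
  "graph_on n G \<longleftrightarrow> pair_graph G \<and> pverts G = {0..<n}"

definition complement_graph :: "'a pair_pre_digraph \<Rightarrow> 'a pair_pre_digraph" where
  "complement_graph G = \<lparr> pverts = pverts G,
     parcs = {(u, v). u \<in> pverts G \<and> v \<in> pverts G \<and> u \<noteq> v \<and> (u, v) \<notin> parcs G} \<rparr>"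

lemma graph_on_complement_graph:
  assumes "graph_on n G"
  shows "graph_on n (complement_graph G)"
proof -
  interpret pair_graph G
    using assms by (simp add: graph_on_def)
  have "(v, u) \<in> parcs G" if "(u, v) \<in> parcs G" for u v
    using pair_sym_arcs that by (auto simp: symmetric_def elim: symE)
  then have "pair_graph (complement_graph G)"
    using pair_finite_verts
    by unfold_locales
      (auto simp: complement_graph_def symmetric_def intro!: symI
        intro: finite_subset[of _ "pverts G \<times> pverts G"])
  then show ?thesis
    using assms by (simp add: graph_on_def complement_graph_def)
qed

definition adjacency_mat :: "nat pair_pre_digraph \<Rightarrow> 'r :: {zero, one} mat" where
  "adjacency_mat G = mat (card (pverts G)) (card (pverts G))
     (\<lambda>(i, j). if (i, j) \<in> parcs G then 1 else 0)"

text \<open>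
  The eigenvalues are counted with their multiplicity as roots of the characteristic polynomial,
  taken over the complex numbers, where that polynomial splits.
\<close>

definition graph_spectrum :: "nat pair_pre_digraph \<Rightarrow> complex multiset" where
  "graph_spectrum G = proots (char_poly (adjacency_mat G))"

definition generalized_spectrum ::
  "nat pair_pre_digraph \<Rightarrow> complex multiset \<times> complex multiset" where
  "generalized_spectrum G = (graph_spectrum G, graph_spectrum (complement_graph G))"

definition DGS :: "nat pair_pre_digraph \<Rightarrow> bool" where
  "DGS G \<longleftrightarrow> (\<forall>m H. graph_on m H \<and> generalized_spectrum H = generalized_spectrum G
     \<longrightarrow> digraph_iso (with_proj G) (with_proj H))"

definition walk_mat :: "nat pair_pre_digraph \<Rightarrow> int mat" where
  "walk_mat G = (let n = card (pverts G) in
     mat_of_cols n (map (\<lambda>k. (adjacency_mat G ^\<^sub>m k) *\<^sub>v vec n (\<lambda>_. 1)) [0..<n]))"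

end

theory Submission
  imports Defs
begin

text \<open>
  The two characteristic polynomials determine, by the matrix determinant lemma, all the walk numbers
  \<open>e \<bullet> A\<^sup>k e\<close>. Hence a graph with adjacency matrix \<open>B\<close> and the same generalized spectrum has a walk
  matrix \<open>V\<close> with the same Gram matrix as \<open>W\<close>, and \<open>W V\<^sup>-\<^sup>1 = U / l\<close> is a rational orthogonal
  matrix that fixes \<open>e\<close> and conjugates \<open>B\<close> to \<open>A\<close>; here \<open>U\<close> is integral and \<open>l\<close> minimal. If a prime
  \<open>p\<close> divides \<open>l\<close>, some column \<open>u\<close> of \<open>U\<close> is nonzero modulo \<open>p\<close>, orthogonal to all \<open>A\<^sup>k e\<close> modulo
  \<open>p\<close>, and satisfies \<open>p\<^sup>2 dvd u \<bullet> A\<^sup>k u\<close> for all \<open>k\<close>. This forces \<open>p\<^sup>2 dvd det W\<close>. For \<open>p = 2\<close> it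
  forces moreover that \<open>det W / 2^(n div 2)\<close> is even, because \<open>u\<close> and the first \<open>n div 2\<close> isotropic
  vectors \<open>A\<^sup>k e\<close> are dependent modulo 2. So \<open>l = 1\<close>, and \<open>U\<close> is a permutation matrix.
\<close>

section \<open>Linear algebra modulo a prime\<close>

text \<open>Vectors stay integral instead of being reduced to a field with \<open>p\<close>
  elements, since congruences modulo \<open>p\<close> and modulo \<open>p^2\<close> are combined in
  the same arguments.\<close>

definition vdvd :: "int \<Rightarrow> int vec \<Rightarrow> bool" where
  "vdvd p v \<longleftrightarrow> (\<forall>i<dim_vec v. p dvd v $ i)"

lemma vdvd_minus: "vdvd p v \<Longrightarrow> vdvd p w \<Longrightarrow> dim_vec v = dim_vec w \<Longrightarrow> vdvd p (v - w)"
  by (auto simp: vdvd_def)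

lemma vdvd_smult: "vdvd p v \<Longrightarrow> vdvd p (c \<cdot>\<^sub>v v)"
  by (auto simp: vdvd_def)

lemma vdvd_smult_self: "vdvd p (p \<cdot>\<^sub>v v)"
  by (auto simp: vdvd_def)

lemma vdvd_scalar_prod_mult:
  assumes "vdvd p v" "vdvd q w" "dim_vec v = dim_vec w"
  shows "p * q dvd v \<bullet> w"
  using assms unfolding scalar_prod_def vdvd_def by (intro dvd_sum mult_dvd_mono) auto

lemma vdvd_scalar_prod_right:
  assumes "vdvd p w" "dim_vec v = dim_vec w"
  shows "p dvd v \<bullet> w"
  using assms unfolding scalar_prod_def vdvd_def by (intro dvd_sum dvd_mult) auto

lemma vdvd_mult_mat_vec:
  assumes "vdvd p v" "dim_col A = dim_vec v"
  shows "vdvd p (A *\<^sub>v v)"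
  using assms by (auto simp: vdvd_def[of p "A *\<^sub>v v"] intro!: vdvd_scalar_prod_right)

lemma vdvd_obtain:
  assumes "vdvd p v" "v \<in> carrier_vec n"
  obtains w where "w \<in> carrier_vec n" "v = p \<cdot>\<^sub>v w"
proof
  show "vec n (\<lambda>i. v $ i div p) \<in> carrier_vec n"
    by simp
  show "v = p \<cdot>\<^sub>v vec n (\<lambda>i. v $ i div p)"
    using assms by (intro eq_vecI) (auto simp: vdvd_def)
qed

lemma mult_mat_vec_smult:
  fixes A :: "'a :: comm_ring_1 mat"
  assumes "dim_col A = dim_vec v"
  shows "A *\<^sub>v (k \<cdot>\<^sub>v v) = k \<cdot>\<^sub>v (A *\<^sub>v v)"
  using assms by (intro eq_vecI) auto

lemma smult_mat_mult_mat_vec: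
  fixes A :: "'a :: comm_ring_1 mat"
  assumes "dim_col A = dim_vec v"
  shows "(k \<cdot>\<^sub>m A) *\<^sub>v v = k \<cdot>\<^sub>v (A *\<^sub>v v)"
  using assms by (intro eq_vecI) (auto simp: scalar_prod_def sum_distrib_left mult.assoc)

section \<open>Adjugates and kernels modulo a prime\<close>

lemma adj_mat_mult_mat_vec:
  assumes M: "M \<in> carrier_mat n n" and v: "v \<in> carrier_vec n"
  shows "adj_mat M *\<^sub>v (M *\<^sub>v v) = det M \<cdot>\<^sub>v v"
proof -
  have "adj_mat M *\<^sub>v (M *\<^sub>v v) = (det M \<cdot>\<^sub>m 1\<^sub>m n) *\<^sub>v v"
    using adj_mat[OF M] M v by (metis assoc_mult_mat_vec)
  also have "\<dots> = det M \<cdot>\<^sub>v v"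
    using v by (simp add: smult_mat_mult_mat_vec)
  finally show ?thesis .
qed

text \<open>The adjugate sends \<open>M v\<close> to \<open>det M\<close> times \<open>v\<close>, so
  \<open>p\<close> divides every entry of that multiple; an entry of \<open>v\<close> prime to
  \<open>p\<close> leaves only \<open>det M\<close>.\<close>

lemma prime_dvd_det_if_kernel:
  fixes M :: "int mat"
  assumes M: "M \<in> carrier_mat n n" and v: "v \<in> carrier_vec n"
    and "vdvd p (M *\<^sub>v v)" and "prime p" and "\<not> vdvd p v"
  shows "p dvd det M"
proof -
  note adj = adj_mat[OF M]
  have "adj_mat M *\<^sub>v (M *\<^sub>v v) = det M \<cdot>\<^sub>v v"
    using M v by (rule adj_mat_mult_mat_vec)
  moreover have "vdvd p (adj_mat M *\<^sub>v (M *\<^sub>v v))"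
    using assms adj(1) by (auto intro: vdvd_mult_mat_vec[of p "M *\<^sub>v v"])
  ultimately have "p dvd det M * v $ i" if "i < n" for i
    using that v by (auto simp: vdvd_def)
  then show ?thesis
    using assms(4,5) v by (auto simp: vdvd_def prime_dvd_mult_iff)
qed

text \<open>The factor \<open>p\<close> is pulled out of both columns by a diagonal matrix of
  determinant \<open>p * p\<close>.\<close>

lemma dvd_det_two_cols:
  fixes M :: "int mat"
  assumes M: "M \<in> carrier_mat n n" and ij: "i < n" "j < n" "i \<noteq> j"
    and "\<And>r. r < n \<Longrightarrow> p dvd M $$ (r, i)" and "\<And>r. r < n \<Longrightarrow> p dvd M $$ (r, j)"
  shows "p\<^sup>2 dvd det M"
proof -
  define N where "N = mat n n (\<lambda>(r, k). if k = i \<or> k = j then M $$ (r, k) div p else M $$ (r, k))"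
  define D where "D = mat_diag n (\<lambda>k. if k = i \<or> k = j then p else 1)"
  have "M = N * D"
    unfolding D_def using M assms(5,6)
    by (subst mat_diag_mult_right[of _ n]) (auto simp: N_def intro!: eq_matI)
  moreover have "det D = p * p"
  proof -
    have "det D = (\<Prod>k<n. if k = i \<or> k = j then p else 1)"
      unfolding D_def by (subst det_upper_triangular[where n = n])
        (auto simp: mat_diag_def upper_triangular_def prod_list_diag_prod atLeast0LessThan)
    also have "\<dots> = (\<Prod>k\<in>{i, j}. p)"
      using ij by (intro prod.mono_neutral_cong_right) auto
    finally show ?thesis
      using ij by simp
  qed
  moreover have "det (N * D) = det N * det D"
    by (rule det_mult[of _ n]) (auto simp: N_def D_def)
  ultimately show ?thesis
    by (simp add: power2_eq_square)
qed

lemma prime_dvd_if_square_dvd_mult: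
  fixes p :: int
  assumes "prime p" "p\<^sup>2 dvd x * y" "\<not> p\<^sup>2 dvd y"
  shows "p dvd x"
  using assms by (metis coprime_dvd_mult_right_iff coprime_power_left_iff prime_imp_coprime)

text \<open>The kernel of \<open>W\<close> modulo \<open>p\<close> is at most a line, expressed by 2
  by 2 minors. Two independent kernel vectors would allow two columns of \<open>W\<close> to be
  replaced by columns divisible by \<open>p\<close>, while the determinant only changes by a known
  factor.\<close>

lemma kernel_mod_proportional:
  fixes W :: "int mat"
  assumes W: "W \<in> carrier_mat n n" and f: "f \<in> carrier_vec n" and g: "g \<in> carrier_vec n"
    and Wf: "vdvd p (W *\<^sub>v f)" and Wg: "vdvd p (W *\<^sub>v g)"
    and p: "prime p" "\<not> p\<^sup>2 dvd det W" and ij: "i < n" "j < n"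
  shows "p dvd g $ i * f $ j - f $ i * g $ j"
proof -
  have *: "p dvd (g $ i * f $ j - f $ i * g $ j) * g $ i"
    if f: "f \<in> carrier_vec n" and g: "g \<in> carrier_vec n"
      and Wf: "vdvd p (W *\<^sub>v f)" and Wg: "vdvd p (W *\<^sub>v g)" and "i \<noteq> j" for f g
  proof -
    define W1 where "W1 = replace_col W (W *\<^sub>v g) i"
    \<comment> \<open>The combination is chosen so that \<open>h $ i = 0\<close>: replacing column
      \<open>i\<close> then does not change the product with \<open>h\<close>.\<close>
    define h where "h = g $ i \<cdot>\<^sub>v f - f $ i \<cdot>\<^sub>v g"
    define W2 where "W2 = replace_col W1 (W1 *\<^sub>v h) j"
    have W1: "W1 \<in> carrier_mat n n" and W2: "W2 \<in> carrier_mat n n" and h: "h \<in> carrier_vec n"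
      using W f g by (auto simp: W1_def W2_def replace_col_def h_def)
    have "W1 *\<^sub>v h = W *\<^sub>v h"
      using W W1 h ij f g
      by (intro eq_vecI) (auto simp: scalar_prod_def W1_def replace_col_def h_def intro!: sum.cong)
    also have "\<dots> = g $ i \<cdot>\<^sub>v (W *\<^sub>v f) - f $ i \<cdot>\<^sub>v (W *\<^sub>v g)"
      using W f g unfolding h_def
      by (subst mult_minus_distrib_mat_vec[of _ n n]) (auto simp: mult_mat_vec_smult)
    finally have W1h: "vdvd p (W1 *\<^sub>v h)"
      using Wf Wg W by (simp add: vdvd_minus vdvd_smult)
    have "p\<^sup>2 dvd det W2"
    proof (rule dvd_det_two_cols[OF W2 ij \<open>i \<noteq> j\<close>])
      show "p dvd W2 $$ (r, i)" if "r < n" for r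
        using that Wg W ij \<open>i \<noteq> j\<close> by (auto simp: W2_def W1_def replace_col_def vdvd_def)
      show "p dvd W2 $$ (r, j)" if "r < n" for r
        using that W1h W1 ij by (auto simp: W2_def replace_col_def vdvd_def)
    qed
    \<comment> \<open>Cramer's rule, twice: replacing column \<open>k\<close> of a matrix
      \<open>M\<close> by \<open>M x\<close> multiplies the determinant by
      \<open>x $ k\<close>.\<close>
    also have "det W2 = h $ j * (g $ i * det W)"
      unfolding W2_def W1_def
      using cramer_lemma_mat[OF W1 h \<open>j < n\<close>] cramer_lemma_mat[OF W g \<open>i < n\<close>] by (simp add: W1_def)
    also have "\<dots> = ((g $ i * f $ j - f $ i * g $ j) * g $ i) * det W"
      using f g ij by (simp add: h_def)
    finally show ?thesis
      using prime_dvd_if_square_dvd_mult p by blast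
  qed
  show ?thesis
  proof (cases "i = j")
    case False
    \<comment> \<open>If \<open>p\<close> did not divide the minor, it would divide both
      \<open>g $ i\<close> and \<open>f $ i\<close>, and hence the minor after all.\<close>
    have "p dvd (g $ i * f $ j - f $ i * g $ j) * g $ i" "p dvd (f $ i * g $ j - g $ i * f $ j) * f $ i"
      using * f g Wf Wg False by blast+
    then show ?thesis
      using p(1) by (metis dvd_diff dvd_mult2 dvd_diff_commute prime_dvd_multD)
  qed (simp add: mult.commute)
qed

section \<open>Krylov matrices\<close>

definition krylov :: "'a :: comm_ring_1 mat \<Rightarrow> 'a vec \<Rightarrow> nat \<Rightarrow> 'a vec" where
  "krylov A v k = ((\<lambda>w. A *\<^sub>v w) ^^ k) v"

definition krylov_mat :: "'a :: comm_ring_1 mat \<Rightarrow> 'a vec \<Rightarrow> 'a mat" where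
  "krylov_mat A v = mat (dim_row A) (dim_row A) (\<lambda>(i, k). krylov A v k $ i)"

text \<open>Multiplication by the variable X, when a vector is read as the coefficient list of a
  polynomial; the top coefficient is lost.\<close>

definition shift_vec :: "'a :: zero vec \<Rightarrow> 'a vec" where
  "shift_vec v = vec (dim_vec v) (\<lambda>i. if i = 0 then 0 else v $ (i - 1))"

lemma krylov_0 [simp]: "krylov A v 0 = v"
  by (simp add: krylov_def)

lemma krylov_Suc: "krylov A v (Suc k) = A *\<^sub>v krylov A v k"
  by (simp add: krylov_def)

lemma krylov_carrier [simp]:
  assumes "A \<in> carrier_mat n n" "v \<in> carrier_vec n"
  shows "krylov A v k \<in> carrier_vec n"
  using assms by (induction k) (auto simp: krylov_Suc)

lemma krylov_mat_carrier [simp]: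
  "A \<in> carrier_mat n n \<Longrightarrow> krylov_mat A v \<in> carrier_mat n n"
  by (simp add: krylov_mat_def)

lemma shift_vec_carrier [simp]: "v \<in> carrier_vec n \<Longrightarrow> shift_vec v \<in> carrier_vec n"
  by (simp add: shift_vec_def)

lemma krylov_mat_mult_vec_nth:
  assumes "A \<in> carrier_mat n n" "q \<in> carrier_vec n" "i < n"
  shows "(krylov_mat A v *\<^sub>v q) $ i = (\<Sum>k<n. krylov A v k $ i * q $ k)"
  using assms by (auto simp: krylov_mat_def scalar_prod_def atLeast0LessThan)

text \<open>With \<open>q\<close> read as a polynomial, \<open>krylov_mat A v\<close> times
  \<open>q\<close> is \<open>q(A) v\<close>. Applying \<open>A\<close> multiplies \<open>q\<close>
  by X, and the coefficient that \<open>shift_vec\<close> drops returns as the multiple of the first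
  power beyond the matrix.\<close>

lemma mult_krylov_mat_shift:
  assumes A: "A \<in> carrier_mat (Suc n) (Suc n)" and v: "v \<in> carrier_vec (Suc n)"
    and q: "q \<in> carrier_vec (Suc n)"
  shows "A *\<^sub>v (krylov_mat A v *\<^sub>v q)
       = krylov_mat A v *\<^sub>v shift_vec q + q $ n \<cdot>\<^sub>v krylov A v (Suc n)"
proof (intro eq_vecI)
  fix i
  assume "i < dim_vec (krylov_mat A v *\<^sub>v shift_vec q + q $ n \<cdot>\<^sub>v krylov A v (Suc n))"
  then have i: "i < Suc n"
    using A v by (simp add: krylov_Suc)
  have "(A *\<^sub>v (krylov_mat A v *\<^sub>v q)) $ i
      = (\<Sum>j<Suc n. A $$ (i, j) * (\<Sum>k<Suc n. krylov A v k $ j * q $ k))"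
  proof -
    have "(A *\<^sub>v (krylov_mat A v *\<^sub>v q)) $ i
        = (\<Sum>j<Suc n. A $$ (i, j) * (krylov_mat A v *\<^sub>v q) $ j)"
      using A i by (auto simp: scalar_prod_def atLeast0LessThan krylov_mat_def simp del: sum.lessThan_Suc)
    then show ?thesis
      using krylov_mat_mult_vec_nth[OF A q] by simp
  qed
  also have "\<dots> = (\<Sum>k<Suc n. (\<Sum>j<Suc n. A $$ (i, j) * krylov A v k $ j) * q $ k)"
    unfolding sum_distrib_left sum_distrib_right by (subst sum.swap) (simp only: mult.assoc)
  also have "\<dots> = (\<Sum>k<Suc n. krylov A v (Suc k) $ i * q $ k)"
  proof -
    have "krylov A v (Suc k) $ i = (\<Sum>j<Suc n. A $$ (i, j) * krylov A v k $ j)" for k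
      using A i carrier_vecD[OF krylov_carrier[OF A v, of k]]
      by (auto simp: krylov_Suc scalar_prod_def atLeast0LessThan simp del: sum.lessThan_Suc)
    then show ?thesis
      by simp
  qed
  also have "\<dots> = (\<Sum>k<n. krylov A v (Suc k) $ i * q $ k) + krylov A v (Suc n) $ i * q $ n"
    by simp
  also have "(\<Sum>k<n. krylov A v (Suc k) $ i * q $ k) = (krylov_mat A v *\<^sub>v shift_vec q) $ i"
    using A i q
    by (subst krylov_mat_mult_vec_nth[OF A]) (auto simp: shift_vec_def sum.lessThan_Suc_shift simp del: sum.lessThan_Suc)
  finally show "(A *\<^sub>v (krylov_mat A v *\<^sub>v q)) $ i
      = (krylov_mat A v *\<^sub>v shift_vec q + q $ n \<cdot>\<^sub>v krylov A v (Suc n)) $ i"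
    using A i v by (simp add: krylov_Suc mult.commute)
qed (use A v in \<open>auto simp: krylov_mat_def krylov_Suc\<close>)

text \<open>The index \<open>t\<close> is the degree of \<open>v\<close> modulo \<open>p\<close>,
  again with \<open>v\<close> read as a polynomial.\<close>

lemma last_nonzero_entry:
  assumes "\<not> vdvd p v"
  obtains t where "t < dim_vec v" "\<not> p dvd v $ t" "\<And>i. t < i \<Longrightarrow> i < dim_vec v \<Longrightarrow> p dvd v $ i"
proof -
  let ?S = "{i. i < dim_vec v \<and> \<not> p dvd v $ i}"
  have "finite ?S" "?S \<noteq> {}"
    using assms by (auto simp: vdvd_def)
  then have "Max ?S \<in> ?S" "\<And>i. i \<in> ?S \<Longrightarrow> i \<le> Max ?S"
    using Max_in Max_ge by blast+
  then show ?thesis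
    by (intro that[of "Max ?S"]) (auto simp: not_le[symmetric])
qed

lemma mat_mult_col_adj_mat:
  assumes A: "A \<in> carrier_mat n n" and j: "j < n"
  shows "A *\<^sub>v col (adj_mat A) j = det A \<cdot>\<^sub>v unit_vec n j"
proof -
  have "A *\<^sub>v col (adj_mat A) j = col (A * adj_mat A) j"
    using adj_mat(1)[OF A] A j by (intro eq_vecI) auto
  also have "\<dots> = det A \<cdot>\<^sub>v unit_vec n j"
    using j unfolding adj_mat(2)[OF A] by (intro eq_vecI) (auto simp: unit_vec_def)
  finally show ?thesis .
qed

text \<open>Row \<open>i\<close> of the adjugate holds the cofactors along column \<open>i\<close>,
  and these do not see that column.\<close>

lemma adj_mat_replace_col:
  assumes "A \<in> carrier_mat n n" "i < n" "j < n"
  shows "adj_mat (replace_col A b i) $$ (i, j) = adj_mat A $$ (i, j)"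
proof -
  have "mat_delete (replace_col A b i) j i = mat_delete A j i"
    using assms by (intro eq_matI) (auto simp: mat_delete_def replace_col_def)
  then show ?thesis
    using assms by (simp add: adj_mat_def cofactor_def) (simp add: replace_col_def)
qed

lemma vdvd_transpose_krylov_mat:
  fixes A :: "int mat"
  assumes A: "A \<in> carrier_mat n n" and v: "v \<in> carrier_vec n" and u: "u \<in> carrier_vec n"
    and dvd: "\<And>k. k < n \<Longrightarrow> p dvd u \<bullet> krylov A v k"
  shows "vdvd p (transpose_mat (krylov_mat A v) *\<^sub>v u)"
  unfolding vdvd_def
proof (intro allI impI)
  fix k assume "k < dim_vec (transpose_mat (krylov_mat A v) *\<^sub>v u)"
  then have k: "k < n"
    using A by (simp add: krylov_mat_def)
  have "col (krylov_mat A v) k = krylov A v k"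
    using A v k by (intro eq_vecI) (auto simp: krylov_mat_def carrier_vecD[OF krylov_carrier[OF A v]])
  then have "(transpose_mat (krylov_mat A v) *\<^sub>v u) $ k = krylov A v k \<bullet> u"
    using A k by (simp add: krylov_mat_def)
  also have "\<dots> = u \<bullet> krylov A v k"
    using A v u by (intro comm_scalar_prod[of _ n]) auto
  finally show "p dvd (transpose_mat (krylov_mat A v) *\<^sub>v u) $ k"
    using dvd k by simp
qed

text \<open>
  If \<open>p\<^sup>2\<close> does not divide \<open>det W\<close>, the kernels of \<open>W\<close> and of its transpose modulo \<open>p\<close> are lines.
  The second one is spanned by \<open>u\<close>, so \<open>u\<close> is an eigenvector of \<open>A\<close> modulo \<open>p\<close>, say for \<open>b / a\<close>;
  as \<open>u\<close> is isotropic, a multiple of it is \<open>W q\<close> modulo \<open>p\<close>. Regarding vectors \<open>q\<close> as polynomials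
  acting on \<open>v\<close>, the product \<open>g\<close> of \<open>q\<close> with \<open>a X - b\<close> spans the kernel of \<open>W\<close>, and
  \<open>u \<bullet> W g\<close> vanishes modulo \<open>p\<^sup>2\<close>. Hence so does \<open>u \<bullet> W f\<close> for every \<open>f\<close> in that kernel, in particular
  for a column \<open>f\<close> of the adjugate of \<open>W\<close>.
\<close>

lemma square_dvd_det_krylov_mat:
  fixes A :: "int mat"
  assumes A: "A \<in> carrier_mat n n" and sym: "transpose_mat A = A"
    and v: "v \<in> carrier_vec n" and u: "u \<in> carrier_vec n"
    and p: "prime p" and nu: "\<not> vdvd p u"
    and uk: "\<And>k. p dvd u \<bullet> krylov A v k"
    and uu: "p\<^sup>2 dvd u \<bullet> u" and uAu: "p\<^sup>2 dvd u \<bullet> (A *\<^sub>v u)"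
  shows "p\<^sup>2 dvd det (krylov_mat A v)"
proof (rule ccontr)
  define W where "W = krylov_mat A v"
  assume "\<not> ?thesis"
  then have np: "\<not> p\<^sup>2 dvd det W"
    by (simp add: W_def)
  have W: "W \<in> carrier_mat n n" and WT: "transpose_mat W \<in> carrier_mat n n"
    using A by (auto simp: W_def)
  have npT: "\<not> p\<^sup>2 dvd det (transpose_mat W)"
    using np W by (simp add: det_transpose)
  obtain j where j: "j < n" and uj: "\<not> p dvd u $ j"
    using nu u by (auto simp: vdvd_def)
  obtain m where m: "n = Suc m"
    using j by (cases n) auto
  have Au: "A *\<^sub>v u \<in> carrier_vec n"
    using A u by simp
  have WTu: "vdvd p (transpose_mat W *\<^sub>v u)"
    unfolding W_def using A v u uk by (rule vdvd_transpose_krylov_mat)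
  have WTAu: "vdvd p (transpose_mat W *\<^sub>v (A *\<^sub>v u))"
    unfolding W_def
  proof (rule vdvd_transpose_krylov_mat[OF A v Au])
    fix k
    have "(A *\<^sub>v u) \<bullet> krylov A v k = u \<bullet> krylov A v (Suc k)"
      using transpose_vec_mult_scalar[OF A krylov_carrier[OF A v] u, of k] sym
      by (simp add: krylov_Suc)
    then show "p dvd (A *\<^sub>v u) \<bullet> krylov A v k"
      using uk by simp
  qed
  have uW: "u \<bullet> (W *\<^sub>v x) = (transpose_mat W *\<^sub>v u) \<bullet> x" if "x \<in> carrier_vec n" for x
    using transpose_vec_mult_scalar[OF W that u] by simp
  have uWdvd: "p\<^sup>2 dvd u \<bullet> (W *\<^sub>v x)" if "x \<in> carrier_vec n" "vdvd p x" for x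
    using vdvd_scalar_prod_mult[OF WTu that(2)] that W
    by (simp add: uW power2_eq_square)
  have pW: "p dvd det W"
    using prime_dvd_det_if_kernel[OF WT u WTu p nu] W by (simp add: det_transpose)

  define f where "f = col (adj_mat W) j"
  have f: "f \<in> carrier_vec n"
    using adj_mat(1)[OF W] by (auto simp: f_def)
  have Wf: "W *\<^sub>v f = det W \<cdot>\<^sub>v unit_vec n j"
    unfolding f_def using W j by (rule mat_mult_col_adj_mat)
  then have vWf: "vdvd p (W *\<^sub>v f)"
    using pW by (auto simp: vdvd_def)
  have uWf: "u \<bullet> (W *\<^sub>v f) = u $ j * det W"
    using u j by (simp add: Wf)
  \<comment> \<open>Otherwise \<open>p^2\<close> would divide \<open>u $ j * det W\<close>, with
    \<open>u $ j\<close> prime to \<open>p\<close>.\<close>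
  have nf: "\<not> vdvd p f"
    using uWdvd[OF f] uWf uj np p prime_dvd_if_square_dvd_mult by metis
  have shift_ker: "A *\<^sub>v (W *\<^sub>v x) = W *\<^sub>v shift_vec x + x $ m \<cdot>\<^sub>v krylov A v n"
    if "x \<in> carrier_vec n" for x
    using mult_krylov_mat_shift[of A m v x] A v that by (simp add: W_def m)
  define d where "d = f $ m"
  \<comment> \<open>If the top coefficient of \<open>f\<close> vanished modulo \<open>p\<close>, X
    times \<open>f\<close> would lie in the kernel too, with a larger degree modulo
    \<open>p\<close>; no multiple of \<open>f\<close> has that.\<close>
  have nd: "\<not> p dvd d"
  proof
    assume d: "p dvd d"
    have "W *\<^sub>v shift_vec f = A *\<^sub>v (W *\<^sub>v f) - d \<cdot>\<^sub>v krylov A v n"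
      using shift_ker[OF f] A v W f by (intro eq_vecI) (auto simp: d_def carrier_vecD[OF krylov_carrier[OF A v]])
    moreover have "vdvd p (A *\<^sub>v (W *\<^sub>v f))"
      using vWf A W by (auto intro: vdvd_mult_mat_vec[of p "W *\<^sub>v f"])
    moreover have "vdvd p (d \<cdot>\<^sub>v krylov A v n)"
      using d by (auto simp: vdvd_def)
    ultimately have ker: "vdvd p (W *\<^sub>v shift_vec f)"
      using A carrier_vecD[OF krylov_carrier[OF A v, of n]] by (simp add: vdvd_minus)
    obtain t where t: "t < n" "\<not> p dvd f $ t" "\<And>i. t < i \<Longrightarrow> i < n \<Longrightarrow> p dvd f $ i"
      using last_nonzero_entry[OF nf] f by auto
    have "t < m"
      using t d m unfolding d_def by (metis less_Suc_eq)
    then have "p dvd shift_vec f $ t * f $ Suc t - f $ t * shift_vec f $ Suc t"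
      using f ker vWf W np p m by (intro kernel_mod_proportional[of W n]) auto
    moreover have "shift_vec f $ Suc t = f $ t"
      using \<open>t < m\<close> f m by (simp add: shift_vec_def)
    moreover have "p dvd shift_vec f $ t * f $ Suc t"
      using t(3)[of "Suc t"] \<open>t < m\<close> m by simp
    ultimately have "p dvd f $ t * f $ t"
      by (metis dvd_diff_right_iff)
    with t p show False
      by (simp add: prime_dvd_mult_iff)
  qed

  \<comment> \<open>Isotropy of \<open>u\<close> keeps the matrix with last column \<open>u\<close>
    singular modulo \<open>p\<close>. The last entry of its kernel vector \<open>h\<close> is the
    same cofactor \<open>d\<close>, a unit modulo \<open>p\<close>, so \<open>d u\<close> is a
    combination of the other columns of \<open>W\<close> modulo \<open>p\<close>.\<close>
  define W2 where "W2 = replace_col W u m"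
  have W2: "W2 \<in> carrier_mat n n"
    using W by (simp add: W2_def replace_col_def)
  have "vdvd p (transpose_mat W2 *\<^sub>v u)"
    unfolding vdvd_def
  proof (intro allI impI)
    fix k assume "k < dim_vec (transpose_mat W2 *\<^sub>v u)"
    then have k: "k < n" using W2 by simp
    have "col W2 k = (if k = m then u else col W k)"
      using W u k by (intro eq_vecI) (auto simp: W2_def replace_col_def)
    then have "(transpose_mat W2 *\<^sub>v u) $ k = (if k = m then u \<bullet> u else (transpose_mat W *\<^sub>v u) $ k)"
      using W W2 k by simp
    moreover have "p dvd u \<bullet> u"
      using uu by (metis dvd_trans dvd_triv_left power2_eq_square)
    ultimately show "p dvd (transpose_mat W2 *\<^sub>v u) $ k"
      using WTu k W by (auto simp: vdvd_def)
  qed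
  then have pW2: "p dvd det W2"
    using prime_dvd_det_if_kernel[of "transpose_mat W2" n u p] W2 u p nu by (simp add: det_transpose)
  define h where "h = col (adj_mat W2) j"
  have h: "h \<in> carrier_vec n"
    using adj_mat(1)[OF W2] by (auto simp: h_def)
  have hm: "h $ m = d"
    using adj_mat_replace_col[OF W, of m j u] adj_mat(1)[OF W] adj_mat(1)[OF W2] j m
    by (simp add: h_def d_def f_def W2_def)
  have "W2 *\<^sub>v h = det W2 \<cdot>\<^sub>v unit_vec n j"
    unfolding h_def using W2 j by (rule mat_mult_col_adj_mat)
  then have "vdvd p (W2 *\<^sub>v h)"
    using pW2 by (auto simp: vdvd_def)
  then obtain s where s: "s \<in> carrier_vec n" "W2 *\<^sub>v h = p \<cdot>\<^sub>v s"
    using W2 h by (metis vdvd_obtain mult_mat_vec_carrier)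
  \<comment> \<open>The last coefficient of \<open>q\<close> is zero, so \<open>shift_vec q\<close>
    is exactly X times \<open>q\<close>.\<close>
  define q where "q = vec n (\<lambda>k. if k = m then 0 else - h $ k)"
  have q: "q \<in> carrier_vec n" and qm: "q $ m = 0"
    by (auto simp: q_def m)
  have "W *\<^sub>v q = d \<cdot>\<^sub>v u - W2 *\<^sub>v h"
  proof (intro eq_vecI)
    fix i assume "i < dim_vec (d \<cdot>\<^sub>v u - W2 *\<^sub>v h)"
    then have i: "i < n" using W2 by simp
    have "(W2 *\<^sub>v h) $ i = (\<Sum>k<m. W $$ (i, k) * h $ k) + u $ i * d"
      using W i h m hm by (simp add: W2_def replace_col_def scalar_prod_def)
        (simp add: atLeast0LessThan)
    moreover have "(W *\<^sub>v q) $ i = - (\<Sum>k<m. W $$ (i, k) * h $ k)"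
      using W i m by (simp add: q_def scalar_prod_def sum_negf) (simp add: atLeast0LessThan)
    ultimately show "(W *\<^sub>v q) $ i = (d \<cdot>\<^sub>v u - W2 *\<^sub>v h) $ i"
      using i u W2 by simp
  qed (use W W2 in auto)
  then have Wq: "W *\<^sub>v q = d \<cdot>\<^sub>v u - p \<cdot>\<^sub>v s"
    using s by simp

  define a where "a = u $ j"
  define b where "b = (A *\<^sub>v u) $ j"
  define r where "r = a \<cdot>\<^sub>v (A *\<^sub>v u) - b \<cdot>\<^sub>v u"
  have r: "r \<in> carrier_vec n"
    using A u by (simp add: r_def)
  have vr: "vdvd p r"
    unfolding vdvd_def
  proof (intro allI impI)
    fix k assume "k < dim_vec r"
    then have k: "k < n" using r by simp
    show "p dvd r $ k"
      using kernel_mod_proportional[OF WT Au u WTAu WTu p npT j k] k A u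
      by (simp add: r_def a_def b_def)
  qed
  define g where "g = a \<cdot>\<^sub>v shift_vec q - b \<cdot>\<^sub>v q"
  have g: "g \<in> carrier_vec n"
    using q by (simp add: g_def)
  define s' where "s' = a \<cdot>\<^sub>v (A *\<^sub>v s) - b \<cdot>\<^sub>v s"
  have s': "s' \<in> carrier_vec n"
    using s A by (simp add: s'_def)
  have "W *\<^sub>v shift_vec q = A *\<^sub>v (W *\<^sub>v q)"
    using shift_ker[OF q] qm W q A v by (intro eq_vecI) (auto simp: carrier_vecD[OF krylov_carrier[OF A v]])
  then have "W *\<^sub>v g = a \<cdot>\<^sub>v (A *\<^sub>v (W *\<^sub>v q)) - b \<cdot>\<^sub>v (W *\<^sub>v q)"
    unfolding g_def using W q
    by (subst mult_minus_distrib_mat_vec[of _ n n])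
      (auto simp: mult_mat_vec_smult carrier_vecD[OF shift_vec_carrier[OF q]])
  also have "A *\<^sub>v (W *\<^sub>v q) = d \<cdot>\<^sub>v (A *\<^sub>v u) - p \<cdot>\<^sub>v (A *\<^sub>v s)"
    unfolding Wq using A u s by (subst mult_minus_distrib_mat_vec[of _ n n]) (auto simp: mult_mat_vec_smult)
  finally have Wg: "W *\<^sub>v g = d \<cdot>\<^sub>v r - p \<cdot>\<^sub>v s'"
    unfolding Wq r_def s'_def using A u s
    by (intro eq_vecI) (auto simp: algebra_simps simp del: index_mult_mat_vec)
  have vWg: "vdvd p (W *\<^sub>v g)"
    unfolding Wg using vr s' r by (intro vdvd_minus vdvd_smult vdvd_smult_self) auto
  \<comment> \<open>Symmetry of \<open>A\<close> moves the operator \<open>a A - b\<close> from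
    \<open>s\<close> to \<open>u\<close>, where it gives \<open>r\<close>, which is zero modulo
    \<open>p\<close>. This supplies the second factor \<open>p\<close> for the term
    \<open>p * (u \<bullet> s')\<close>.\<close>
  have "u \<bullet> s' = r \<bullet> s"
  proof -
    have "u \<bullet> (A *\<^sub>v s) = (A *\<^sub>v u) \<bullet> s"
      using transpose_vec_mult_scalar[OF A s(1) u] sym by simp
    then show ?thesis
      unfolding s'_def r_def using A u s
      by (simp add: scalar_prod_minus_distrib[of _ n] minus_scalar_prod_distrib[of _ n])
  qed
  moreover have "p dvd r \<bullet> s"
    using vdvd_scalar_prod_right[OF vr, of s] s r by (simp add: comm_scalar_prod[of r n])
  ultimately have us': "p dvd u \<bullet> s'"
    by simp
  have "u \<bullet> r = a * (u \<bullet> (A *\<^sub>v u)) - b * (u \<bullet> u)"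
    unfolding r_def using A u by (simp add: scalar_prod_minus_distrib[of _ n])
  then have ur: "p\<^sup>2 dvd u \<bullet> r"
    using uu uAu by simp
  have "u \<bullet> (W *\<^sub>v g) = d * (u \<bullet> r) - p * (u \<bullet> s')"
    unfolding Wg using u r s' by (simp add: scalar_prod_minus_distrib[of _ n])
  then have uWg: "p\<^sup>2 dvd u \<bullet> (W *\<^sub>v g)"
    using ur us' by (auto simp: power2_eq_square)

  have nq: "\<not> vdvd p q"
  proof
    assume "vdvd p q"
    then have "vdvd p (W *\<^sub>v q)"
      using W q by (auto intro: vdvd_mult_mat_vec)
    then have "p dvd d * u $ j - p * s $ j"
      using j u s unfolding Wq vdvd_def by auto
    then have "p dvd d * u $ j"
      by (metis dvd_diff_left_iff dvd_triv_left)
    with p nd uj show False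
      by (simp add: prime_dvd_mult_iff)
  qed
  obtain t where t: "t < n" "\<not> p dvd q $ t" "\<And>i. t < i \<Longrightarrow> i < n \<Longrightarrow> p dvd q $ i"
    using last_nonzero_entry[OF nq] q by auto
  have "t < m"
    using t qm m by (metis dvd_0_right less_Suc_eq)
  \<comment> \<open>\<open>Suc t\<close> is the degree of \<open>g\<close> modulo \<open>p\<close>:
    there only the leading term of \<open>a X q\<close> survives.\<close>
  define i where "i = Suc t"
  have i: "i < n"
    using \<open>t < m\<close> m by (simp add: i_def)
  have "g $ i = a * q $ t - b * q $ i"
    using i q by (simp add: g_def i_def shift_vec_def)
  moreover have "p dvd b * q $ i"
    using t(3)[of i] i by (simp add: i_def)
  moreover have "\<not> p dvd a * q $ t"
    using t(2) uj p by (simp add: a_def prime_dvd_mult_iff)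
  ultimately have gi: "\<not> p dvd g $ i"
    by (metis dvd_diff_left_iff)

  \<comment> \<open>Since the kernel is a line, \<open>z\<close> vanishes modulo \<open>p\<close>;
    this transfers the divisibility of \<open>u \<bullet> W g\<close> by \<open>p^2\<close> to
    \<open>u \<bullet> W f\<close>, up to the unit \<open>g $ i\<close>.\<close>
  define z where "z = g $ i \<cdot>\<^sub>v f - f $ i \<cdot>\<^sub>v g"
  have z: "z \<in> carrier_vec n"
    using f g by (simp add: z_def)
  have "vdvd p z"
    unfolding vdvd_def
  proof (intro allI impI)
    fix k assume "k < dim_vec z"
    then have k: "k < n" using z by simp
    show "p dvd z $ k"
      using kernel_mod_proportional[OF W f g vWf vWg p np i k] k f g
      by (simp add: z_def)
  qed
  then have "p\<^sup>2 dvd u \<bullet> (W *\<^sub>v z)"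
    using uWdvd z by blast
  also have "W *\<^sub>v z = g $ i \<cdot>\<^sub>v (W *\<^sub>v f) - f $ i \<cdot>\<^sub>v (W *\<^sub>v g)"
    unfolding z_def using W f g
    by (subst mult_minus_distrib_mat_vec[of _ n n]) (auto simp: mult_mat_vec_smult)
  also have "u \<bullet> \<dots> = g $ i * (u $ j * det W) - f $ i * (u \<bullet> (W *\<^sub>v g))"
    using u W f g uWf by (simp add: scalar_prod_minus_distrib[of _ n])
  finally have "p\<^sup>2 dvd g $ i * (u $ j * det W)"
    using uWg by (metis dvd_diff_left_iff dvd_mult)
  then have "p\<^sup>2 dvd (g $ i * u $ j) * det W"
    by (simp add: mult.assoc)
  then have "p dvd g $ i * u $ j"
    using p np prime_dvd_if_square_dvd_mult by blast
  with gi uj p show False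
    by (simp add: prime_dvd_mult_iff)
qed

section \<open>Vectors orthogonal to the walk matrix modulo 2\<close>

text \<open>The character of the integers modulo 2, so that parity conditions can be detected by
  sums.\<close>

definition parity_sign :: "int \<Rightarrow> int" where
  "parity_sign z = (if even z then 1 else - 1)"

lemma parity_sign_sum: "parity_sign (\<Sum>i\<in>S. f i) = (\<Prod>i\<in>S. parity_sign (f i))"
proof (induction S rule: infinite_finite_induct)
  case (insert i S)
  then show ?case by (auto simp: parity_sign_def)
qed (auto simp: parity_sign_def)

text \<open>Orthogonality of characters: the sum over all subsets splits into one factor
  \<open>parity_sign (f i) + 1\<close> per element, each being 2 or 0.\<close>

lemma sum_Pow_parity_sign:
  assumes "finite S"
  shows "(\<Sum>T\<in>Pow S. parity_sign (\<Sum>i\<in>T. f i)) = (if \<forall>i\<in>S. even (f i) then 2 ^ card S else 0)"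
proof -
  have "(\<Sum>T\<in>Pow S. parity_sign (\<Sum>i\<in>T. f i)) = (\<Prod>i\<in>S. parity_sign (f i) + 1)"
    using prod_add[OF assms, of "\<lambda>i. parity_sign (f i)" "\<lambda>_. 1"] by (simp add: parity_sign_sum)
  also have "\<dots> = (if \<forall>i\<in>S. even (f i) then 2 ^ card S else 0)"
  proof (cases "\<forall>i\<in>S. even (f i)")
    case True
    then show ?thesis by (simp add: parity_sign_def)
  next
    case False
    then have "\<exists>i\<in>S. parity_sign (f i) + 1 = 0"
      by (auto simp: parity_sign_def)
    then have "(\<Prod>i\<in>S. parity_sign (f i) + 1) = 0"
      using assms by (simp add: prod_zero_iff)
    with False show ?thesis
      by (simp only: if_False)
  qed
  finally show ?thesis .
qed

text \<open>
  Counting proof that an isotropic subspace over the field with two elements has dimension at most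
  \<open>n / 2\<close>. The signs of \<open>\<Sum>k\<in>K. \<Sum>i\<in>Y. v k i\<close> are summed over all sets \<open>K\<close> of vectors and \<open>Y\<close> of
  coordinates. If no nonempty \<open>K\<close> has even sums, the total is \<open>2^n\<close>, whereas the odd supports \<open>Y\<close> of
  the \<open>2^card M\<close> subset sums alone contribute \<open>4^card M\<close>.
\<close>

lemma even_subset_sum_of_even_dot_products:
  fixes v :: "'a \<Rightarrow> nat \<Rightarrow> int"
  assumes M: "finite M" and big: "n < 2 * card M"
    and dot: "\<And>k l. k \<in> M \<Longrightarrow> l \<in> M \<Longrightarrow> even (\<Sum>i<n. v k i * v l i)"
  shows "\<exists>K \<subseteq> M. K \<noteq> {} \<and> (\<forall>i<n. even (\<Sum>k\<in>K. v k i))"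
proof (rule ccontr)
  assume "\<not> ?thesis"
  then have indep: "\<exists>i<n. odd (\<Sum>k\<in>K. v k i)" if "K \<subseteq> M" "K \<noteq> {}" for K
    using that by blast
  define F where "F K Y = parity_sign (\<Sum>k\<in>K. \<Sum>i\<in>Y. v k i)" for K Y
  define supp where "supp K = {i. i < n \<and> odd (\<Sum>k\<in>K. v k i)}" for K
  have "(\<Sum>K\<in>Pow M. \<Sum>Y\<in>Pow {..<n}. F K Y) = (\<Sum>K\<in>Pow M. if K = {} then 2 ^ n else 0)"
  proof (intro sum.cong refl)
    fix K assume "K \<in> Pow M"
    then have "(\<forall>i\<in>{..<n}. even (\<Sum>k\<in>K. v k i)) \<longleftrightarrow> K = {}"
      using indep[of K] by auto
    moreover have "F K Y = parity_sign (\<Sum>i\<in>Y. \<Sum>k\<in>K. v k i)" for Y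
      unfolding F_def by (subst sum.swap) simp
    ultimately show "(\<Sum>Y\<in>Pow {..<n}. F K Y) = (if K = {} then 2 ^ n else 0)"
      using sum_Pow_parity_sign[of "{..<n}" "\<lambda>i. \<Sum>k\<in>K. v k i"] by simp
  qed
  also have "\<dots> = 2 ^ n"
    using M by (simp add: sum.delta)
  finally have upper: "(\<Sum>Y\<in>Pow {..<n}. \<Sum>K\<in>Pow M. F K Y) = 2 ^ n"
    by (subst sum.swap) simp
  have F: "(\<Sum>K\<in>Pow M. F K Y) = (if \<forall>k\<in>M. even (\<Sum>i\<in>Y. v k i) then 2 ^ card M else 0)" for Y
    unfolding F_def by (rule sum_Pow_parity_sign[OF M])
  \<comment> \<open>By independence, a nonempty symmetric difference of \<open>K\<close> and
    \<open>L\<close> has an odd sum in some coordinate, so the supports differ there.\<close>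
  have inj: "inj_on supp (Pow M)"
  proof (rule inj_onI)
    fix K L assume K: "K \<in> Pow M" and L: "L \<in> Pow M" and eq: "supp K = supp L"
    then have fin: "finite K" "finite L"
      using M finite_subset by auto
    have "even (\<Sum>k\<in>(K - L) \<union> (L - K). v k i)" if "i < n" for i
    proof -
      have "(\<Sum>k\<in>(K - L) \<union> (L - K). v k i) = (\<Sum>k\<in>K. v k i) + (\<Sum>k\<in>L. v k i) - 2 * (\<Sum>k\<in>K \<inter> L. v k i)"
        using fin sum.Int_Diff[of K "\<lambda>k. v k i" L] sum.Int_Diff[of L "\<lambda>k. v k i" K]
        by (subst sum.union_disjoint) (auto simp: Int_commute)
      moreover have "odd (\<Sum>k\<in>K. v k i) \<longleftrightarrow> odd (\<Sum>k\<in>L. v k i)"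
        using eq that by (auto simp: supp_def)
      ultimately show ?thesis
        by simp
    qed
    moreover have "(K - L) \<union> (L - K) \<subseteq> M"
      using K L by blast
    ultimately have "(K - L) \<union> (L - K) = {}"
      using indep by blast
    then show "K = L"
      by blast
  qed
  \<comment> \<open>Modulo 2, the sum of \<open>v k\<close> over \<open>supp K\<close> is the dot
    product of \<open>v k\<close> with the sum of the vectors in \<open>K\<close>.\<close>
  have even_supp: "even (\<Sum>i\<in>supp K. v k i)" if "K \<in> Pow M" "k \<in> M" for K k
  proof -
    have "even (\<Sum>l\<in>K. \<Sum>i<n. v k i * v l i)"
      using that by (intro dvd_sum[of K] dot) auto
    also have "(\<Sum>l\<in>K. \<Sum>i<n. v k i * v l i) = (\<Sum>i<n. v k i * (\<Sum>l\<in>K. v l i))"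
      by (subst sum.swap) (simp add: sum_distrib_left)
    also have "\<dots> = (\<Sum>i\<in>supp K. v k i * (\<Sum>l\<in>K. v l i)) + (\<Sum>i\<in>{..<n} - supp K. v k i * (\<Sum>l\<in>K. v l i))"
      by (subst sum.subset_diff[of "supp K" "{..<n}"]) (auto simp: supp_def)
    finally have "even ((\<Sum>i\<in>supp K. v k i * (\<Sum>l\<in>K. v l i)) + (\<Sum>i\<in>{..<n} - supp K. v k i * (\<Sum>l\<in>K. v l i)))" .
    moreover have "even (\<Sum>i\<in>{..<n} - supp K. v k i * (\<Sum>l\<in>K. v l i))"
      by (intro dvd_sum) (auto simp: supp_def)
    ultimately have "even (\<Sum>i\<in>supp K. v k i * (\<Sum>l\<in>K. v l i))"
      by simp
    moreover have "even (\<Sum>i\<in>supp K. v k i * (\<Sum>l\<in>K. v l i) - v k i)"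
      by (intro dvd_sum) (auto simp: supp_def)
    ultimately show ?thesis
      by (simp add: sum_subtractf)
  qed
  have "2 ^ card M * 2 ^ card M = (\<Sum>Y\<in>supp ` Pow M. (2::int) ^ card M)"
    using M by (simp add: card_image[OF inj] card_Pow)
  also have "\<dots> \<le> (\<Sum>Y\<in>supp ` Pow M. \<Sum>K\<in>Pow M. F K Y)"
    using even_supp by (intro sum_mono) (auto simp: F)
  also have "\<dots> \<le> (\<Sum>Y\<in>Pow {..<n}. \<Sum>K\<in>Pow M. F K Y)"
    by (intro sum_mono2) (auto simp: F supp_def)
  also have "\<dots> = 2 ^ n"
    by (rule upper)
  finally have "(2::int) ^ (card M + card M) \<le> 2 ^ n"
    by (simp add: power_add)
  then have "card M + card M \<le> n"
    by (rule power_le_imp_le_exp[rotated]) simp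
  with big show False
    by simp
qed

text \<open>The off-diagonal terms come in equal pairs. With \<open>c = 1\<close> this gives
  parities, with \<open>c = 2\<close> congruences modulo 4.\<close>

lemma dvd_symmetric_double_sum:
  fixes f :: "'a \<Rightarrow> 'a \<Rightarrow> int"
  assumes "finite S" and "\<And>i j. i \<in> S \<Longrightarrow> j \<in> S \<Longrightarrow> f i j = f j i"
    and "\<And>i j. i \<in> S \<Longrightarrow> j \<in> S \<Longrightarrow> i \<noteq> j \<Longrightarrow> c dvd f i j"
  shows "2 * c dvd (\<Sum>i\<in>S. \<Sum>j\<in>S. f i j) - (\<Sum>i\<in>S. f i i)"
  using assms
proof (induction S rule: finite_induct)
  case (insert a S)
  have "(\<Sum>i\<in>insert a S. \<Sum>j\<in>insert a S. f i j) - (\<Sum>i\<in>insert a S. f i i)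
      = ((\<Sum>i\<in>S. \<Sum>j\<in>S. f i j) - (\<Sum>i\<in>S. f i i)) + ((\<Sum>i\<in>S. f i a) + (\<Sum>j\<in>S. f a j))"
    using insert.hyps by (simp add: sum.distrib)
  also have "(\<Sum>j\<in>S. f a j) = (\<Sum>i\<in>S. f i a)"
    using insert.prems(1) by (intro sum.cong) auto
  finally have eq: "(\<Sum>i\<in>insert a S. \<Sum>j\<in>insert a S. f i j) - (\<Sum>i\<in>insert a S. f i i)
      = ((\<Sum>i\<in>S. \<Sum>j\<in>S. f i j) - (\<Sum>i\<in>S. f i i)) + 2 * (\<Sum>i\<in>S. f i a)"
    by simp
  have "c dvd (\<Sum>i\<in>S. f i a)"
    using insert.prems(2) insert.hyps by (intro dvd_sum) auto
  then have "2 * c dvd 2 * (\<Sum>i\<in>S. f i a)"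
    by simp
  moreover have "2 * c dvd (\<Sum>i\<in>S. \<Sum>j\<in>S. f i j) - (\<Sum>i\<in>S. f i i)"
    using insert.prems by (intro insert.IH) auto
  ultimately show ?case
    unfolding eq by (rule dvd_add[rotated])
qed simp

section \<open>Parity of walk numbers and the case p = 2\<close>

definition walks :: "'a :: comm_ring_1 mat \<Rightarrow> nat \<Rightarrow> 'a" where
  "walks A k = vec (dim_row A) (\<lambda>_. 1) \<bullet> krylov A (vec (dim_row A) (\<lambda>_. 1)) k"

lemma krylov_scalar_prod_krylov:
  assumes A: "A \<in> carrier_mat n n" and sym: "transpose_mat A = A" and v: "v \<in> carrier_vec n"
    and w: "w \<in> carrier_vec n"
  shows "krylov A w i \<bullet> krylov A v j = w \<bullet> krylov A v (i + j)"
proof (induction i arbitrary: j)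
  case (Suc i)
  have "krylov A w (Suc i) \<bullet> krylov A v j = krylov A w i \<bullet> krylov A v (Suc j)"
    using transpose_vec_mult_scalar[OF A krylov_carrier[OF A v] krylov_carrier[OF A w], of i j] sym
    by (simp add: krylov_Suc)
  then show ?case
    using Suc[of "Suc j"] by simp
qed simp

text \<open>With \<open>x = A^(k div 2) e\<close>, an even \<open>k\<close> gives
  \<open>x \<bullet> x\<close>, which is congruent to \<open>e \<bullet> x\<close>, a walk number of
  half the length. An odd \<open>k\<close> gives \<open>x \<bullet> A x\<close>, a symmetric double
  sum with zero diagonal.\<close>

lemma even_walks:
  fixes A :: "int mat"
  assumes A: "A \<in> carrier_mat n n" and sym: "transpose_mat A = A"
    and diag: "\<And>i. i < n \<Longrightarrow> A $$ (i, i) = 0" and "k > 0"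
  shows "even (walks A k)"
  using \<open>k > 0\<close>
proof (induction k rule: less_induct)
  case (less k)
  let ?e = "vec n (\<lambda>_. 1) :: int vec"
  have walks: "walks A (i + j) = krylov A ?e i \<bullet> krylov A ?e j" for i j
    using A sym krylov_scalar_prod_krylov[of A n ?e ?e i j] by (simp add: walks_def)
  define x where "x = krylov A ?e (k div 2)"
  have x: "x \<in> carrier_vec n"
    using A by (simp add: x_def)
  show ?case
  proof (cases "even k")
    case True
    have "walks A k = x \<bullet> x"
      using walks[of "k div 2" "k div 2"] True by (simp add: x_def flip: mult_2)
    moreover have "walks A (k div 2) = ?e \<bullet> x"
      using A by (simp add: walks_def x_def)
    ultimately have "walks A k - walks A (k div 2) = (\<Sum>i<n. x $ i * x $ i - x $ i)"
      using x by (simp add: scalar_prod_def sum_subtractf atLeast0LessThan)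
    also have "even \<dots>"
      by (intro dvd_sum) simp
    finally show ?thesis
      using less True by (auto elim!: evenE)
  next
    case False
    then have "k = k div 2 + Suc (k div 2)"
      by presburger
    then have "walks A k = x \<bullet> (A *\<^sub>v x)"
      using walks[of "k div 2" "Suc (k div 2)"] by (simp add: x_def krylov_Suc)
    also have "\<dots> = (\<Sum>i<n. \<Sum>j<n. x $ i * A $$ (i, j) * x $ j)"
      using A x by (auto simp: scalar_prod_def atLeast0LessThan sum_distrib_left mult.assoc intro!: sum.cong)
    finally have "walks A k = (\<Sum>i<n. \<Sum>j<n. x $ i * A $$ (i, j) * x $ j)" .
    moreover have "A $$ (i, j) = A $$ (j, i)" if "i < n" "j < n" for i j
      using that A by (subst sym[symmetric]) simp
    ultimately show ?thesis
      using dvd_symmetric_double_sum[of "{..<n}" "\<lambda>i j. x $ i * A $$ (i, j) * x $ j" 1] diag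
      by simp
  qed
qed

lemma double_sum_krylov:
  fixes A :: "int mat"
  assumes A: "A \<in> carrier_mat n n" and sym: "transpose_mat A = A"
    and e: "e = vec n (\<lambda>_. 1)" and J: "J \<subseteq> {..<n}"
    and x: "x = krylov_mat A e *\<^sub>v vec n (\<lambda>k. if k \<in> J then 1 else 0)"
  shows "x \<bullet> krylov A x k = (\<Sum>i\<in>J. \<Sum>j\<in>J. walks A (i + j + k))"
proof -
  have ec: "e \<in> carrier_vec n"
    by (simp add: e)
  have walks: "walks A k = e \<bullet> krylov A e k" for k
    using A by (simp add: walks_def e)
  have xc: "x \<in> carrier_vec n"
    unfolding x using A by (intro mult_mat_vec_carrier) auto
  have J_eq: "{i. i < n \<and> i \<in> J} = J"
    using J by auto
  have x_nth: "x $ r = (\<Sum>i\<in>J. krylov A e i $ r)" if "r < n" for r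
    unfolding x using J that
    by (subst krylov_mat_mult_vec_nth[OF A])
      (auto simp: sum.If_cases J_eq Int_def intro!: sum.mono_neutral_cong_right)
  have dot: "y \<bullet> x = (\<Sum>i\<in>J. y \<bullet> krylov A e i)" if "y \<in> carrier_vec n" for y
    using xc carrier_vecD[OF krylov_carrier[OF A ec]] that
    by (simp add: scalar_prod_def x_nth sum_distrib_left) (subst sum.swap, simp)
  have "x \<bullet> krylov A x k = krylov A x k \<bullet> x"
    using A xc by (intro comm_scalar_prod[of _ n]) auto
  also have "\<dots> = (\<Sum>i\<in>J. krylov A x k \<bullet> krylov A e i)"
    using A xc by (intro dot) auto
  also have "\<dots> = (\<Sum>i\<in>J. krylov A e (i + k) \<bullet> x)"
  proof (intro sum.cong refl)
    fix i
    have "krylov A x k \<bullet> krylov A e i = x \<bullet> krylov A e (k + i)"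
      using A sym ec xc by (rule krylov_scalar_prod_krylov)
    also have "\<dots> = krylov A e (i + k) \<bullet> x"
      using A ec xc by (subst comm_scalar_prod[of _ n]) (auto simp: add.commute)
    finally show "krylov A x k \<bullet> krylov A e i = krylov A e (i + k) \<bullet> x" .
  qed
  also have "\<dots> = (\<Sum>i\<in>J. \<Sum>j\<in>J. krylov A e (i + k) \<bullet> krylov A e j)"
    using A ec by (intro sum.cong refl dot) auto
  also have "\<dots> = (\<Sum>i\<in>J. \<Sum>j\<in>J. walks A (i + j + k))"
    using krylov_scalar_prod_krylov[OF A sym ec ec] by (simp add: walks ac_simps)
  finally show ?thesis .
qed

lemma krylov_smult:
  fixes A :: "'a :: comm_ring_1 mat"
  assumes A: "A \<in> carrier_mat n n" and "v \<in> carrier_vec n"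
  shows "krylov A (a \<cdot>\<^sub>v v) k = a \<cdot>\<^sub>v krylov A v k"
proof (induction k)
  case (Suc k)
  show ?case
    unfolding krylov_Suc Suc using assms
    by (subst mult_mat_vec_smult) (auto simp: carrier_vecD[OF krylov_carrier[OF A]])
qed simp

lemma krylov_diff_smult:
  fixes A :: "'a :: comm_ring_1 mat"
  assumes A: "A \<in> carrier_mat n n" and "v \<in> carrier_vec n" "w \<in> carrier_vec n"
  shows "krylov A (a \<cdot>\<^sub>v v - b \<cdot>\<^sub>v w) k = a \<cdot>\<^sub>v krylov A v k - b \<cdot>\<^sub>v krylov A w k"
proof (induction k)
  case (Suc k)
  show ?case
    unfolding krylov_Suc Suc using assms
    by (subst mult_minus_distrib_mat_vec[OF A])
      (auto simp: mult_mat_vec_smult carrier_vecD[OF krylov_carrier[OF A]])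
qed simp

text \<open>The two cross terms are equal by symmetry of \<open>A\<close>, so their factor 2 doubles
  to 4.\<close>

lemma four_dvd_krylov_form:
  fixes A :: "int mat"
  assumes A: "A \<in> carrier_mat n n" and sym: "transpose_mat A = A"
    and y: "y \<in> carrier_vec n" and u: "u \<in> carrier_vec n" and "4 dvd b * b * (u \<bullet> krylov A u k)"
  shows "4 dvd (2 \<cdot>\<^sub>v y - b \<cdot>\<^sub>v u) \<bullet> krylov A (2 \<cdot>\<^sub>v y - b \<cdot>\<^sub>v u) k"
proof -
  have K: "krylov A y k \<in> carrier_vec n" "krylov A u k \<in> carrier_vec n"
    using A y u by auto
  have "u \<bullet> krylov A y k = krylov A u k \<bullet> y"
    using krylov_scalar_prod_krylov[OF A sym y u, of k 0] by simp
  also have "\<dots> = y \<bullet> krylov A u k"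
    using K y by (intro comm_scalar_prod[of _ n])
  finally have "(2 \<cdot>\<^sub>v y - b \<cdot>\<^sub>v u) \<bullet> krylov A (2 \<cdot>\<^sub>v y - b \<cdot>\<^sub>v u) k
      = 4 * (y \<bullet> krylov A y k) - 4 * b * (y \<bullet> krylov A u k) + b * b * (u \<bullet> krylov A u k)"
    unfolding krylov_diff_smult[OF A y u] using y u K
    by (simp add: minus_scalar_prod_distrib[of _ n] scalar_prod_minus_distrib[of _ n] algebra_simps)
  also have "4 dvd \<dots>"
    using assms(5) by simp
  finally show ?thesis .
qed

text \<open>The Gram matrix of \<open>W\<close> has walk numbers as entries, all even except the one
  at (0, 0) for odd \<open>n\<close>. Halving its rows from \<open>n mod 2\<close> on leaves a
  matrix \<open>E\<close> of determinant \<open>d * d\<close>, and a dependence modulo 2 between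
  \<open>u\<close> and the isotropic columns indexed by \<open>I\<close> gives a kernel vector of
  \<open>E\<close> modulo 2.\<close>

lemma even_det_krylov_mat_quotient:
  fixes A :: "int mat"
  assumes A: "A \<in> carrier_mat n n" and sym: "transpose_mat A = A"
    and diag: "\<And>i. i < n \<Longrightarrow> A $$ (i, i) = 0"
    and e: "e = vec n (\<lambda>_. 1)" and u: "u \<in> carrier_vec n" and nu: "\<not> vdvd 2 u"
    and uk: "\<And>k. 2 dvd u \<bullet> krylov A e k" and uAu: "\<And>k. 4 dvd u \<bullet> krylov A u k"
    and det: "det (krylov_mat A e) = 2 ^ (n div 2) * d"
  shows "even d"
proof -
  let ?W = "krylov_mat A e"
  have ec: "e \<in> carrier_vec n"
    by (simp add: e)
  have W: "?W \<in> carrier_mat n n"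
    using A by simp
  have walks: "krylov A e i \<bullet> krylov A e j = walks A (i + j)" for i j
    using krylov_scalar_prod_krylov[OF A sym ec ec] A by (simp add: walks_def e)
  have even_w: "even (walks A k)" if "k > 0" for k
    using even_walks[OF A sym diag] that by blast
  have "walks A 0 = int n"
    using A by (simp add: walks_def scalar_prod_def)
  then have even_w': "even (walks A (i + j))" if "i \<ge> n mod 2" for i j
    using that even_w[of "i + j"] by (cases "i + j = 0") auto

  \<comment> \<open>For odd \<open>n\<close> the vector \<open>e\<close> itself is not isotropic
    modulo 2, so the indices start at 1. All \<open>n div 2\<close> indices satisfy
    \<open>2 * i < n\<close>, which lets doubled indices address the columns of
    \<open>E\<close>.\<close>
  define I where "I = {n mod 2..<n mod 2 + n div 2}"
  have I_less: "2 * i < n" if "i \<in> I" for i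
    using that unfolding I_def by simp presburger
  \<comment> \<open>The index \<open>None\<close> stands for \<open>u\<close>, making
    \<open>n div 2 + 1\<close> vectors, too many to be independent with even dot products.\<close>
  define V where "V = case_option (\<lambda>i. u $ i) (\<lambda>k i. krylov A e k $ i)"
  define M where "M = insert None (Some ` I)"
  have "card M = Suc (n div 2)"
    unfolding M_def I_def by (subst card_insert_disjoint) (auto simp: card_image)
  then have "n < 2 * card M"
    by simp
  moreover have "finite M"
    by (simp add: M_def I_def)
  moreover have "even (\<Sum>i<n. V k i * V l i)" if "k \<in> M" "l \<in> M" for k l
  proof -
    have dim: "dim_vec (krylov A e i) = n" for i
      using carrier_vecD[OF krylov_carrier[OF A ec]] by simp
    have uu: "(\<Sum>i<n. u $ i * u $ i) = u \<bullet> krylov A u 0"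
      using u by (simp add: scalar_prod_def atLeast0LessThan)
    have ux: "(\<Sum>i<n. u $ i * krylov A e j $ i) = u \<bullet> krylov A e j"
      "(\<Sum>i<n. krylov A e j $ i * u $ i) = u \<bullet> krylov A e j" for j
      using u by (simp_all add: scalar_prod_def atLeast0LessThan dim mult.commute)
    have xx: "(\<Sum>i<n. krylov A e j $ i * krylov A e j' $ i) = walks A (j + j')" for j j'
      using walks by (simp add: scalar_prod_def atLeast0LessThan dim)
    have "even (u \<bullet> krylov A u 0)"
      using uAu[of 0] by (metis dvd_trans even_numeral)
    then show ?thesis
      using that uk even_w' uu by (auto simp: M_def V_def I_def ux xx)
  qed
  ultimately obtain K where K: "K \<subseteq> M" "K \<noteq> {}" "\<And>i. i < n \<Longrightarrow> even (\<Sum>k\<in>K. V k i)"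
    using even_subset_sum_of_even_dot_products[of M n V] by blast
  define J where "J = {j \<in> I. Some j \<in> K}"
  have finJ: "finite J" and JI: "J \<subseteq> I"
    by (auto simp: J_def I_def)
  have K_eq: "K = (if None \<in> K then {None} else {}) \<union> Some ` J"
    using K(1) by (auto simp: M_def J_def)
  define b :: int where "b = (if None \<in> K then 1 else 0)"
  have K_sum: "(\<Sum>k\<in>K. V k i) = b * u $ i + (\<Sum>j\<in>J. krylov A e j $ i)" for i
    using finJ by (subst K_eq, subst sum.union_disjoint) (auto simp: b_def V_def sum.reindex)
  have "J \<noteq> {}"
  proof
    assume J: "J = {}"
    then have "b = 1"
      using K(2) K_eq by (auto simp: b_def split: if_splits)
    then have "vdvd 2 u"
      using K(3) K_sum u J by (simp add: vdvd_def)
    with nu show False ..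
  qed
  define x where "x = ?W *\<^sub>v vec n (\<lambda>k. if k \<in> J then 1 else 0)"
  have Jn: "J \<subseteq> {..<n}"
    using JI I_less by fastforce
  have x_nth: "x $ r = (\<Sum>j\<in>J. krylov A e j $ r)" if "r < n" for r
    unfolding x_def using Jn that
    by (subst krylov_mat_mult_vec_nth[OF A]) (auto intro!: sum.mono_neutral_cong_right)
  have xc: "x \<in> carrier_vec n"
    unfolding x_def using A by (intro mult_mat_vec_carrier) auto
  have "vdvd 2 (x + b \<cdot>\<^sub>v u)"
    using K(3) K_sum u x_nth by (simp add: vdvd_def add.commute)
  then obtain y where y: "y \<in> carrier_vec n" "x + b \<cdot>\<^sub>v u = 2 \<cdot>\<^sub>v y"
    using xc u vdvd_obtain[of 2 "x + b \<cdot>\<^sub>v u" n] by auto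
  have x_eq: "x = 2 \<cdot>\<^sub>v y - b \<cdot>\<^sub>v u"
    unfolding y(2)[symmetric] using xc u by (intro eq_vecI) auto
  \<comment> \<open>\<open>x\<close> is congruent to a multiple of \<open>u\<close> modulo 2, so its
    quadratic forms inherit divisibility by 4 from those of \<open>u\<close>.\<close>
  have four: "4 dvd x \<bullet> krylov A x k" for k
    unfolding x_eq using A sym y(1) u by (rule four_dvd_krylov_form) (use uAu in auto)
  have four_sum: "4 dvd (\<Sum>i\<in>J. walks A (2 * i + k))" for k
  proof -
    let ?S = "\<Sum>i\<in>J. \<Sum>j\<in>J. walks A (i + j + k)" and ?T = "\<Sum>i\<in>J. walks A (i + i + k)"
    have "x \<bullet> krylov A x k = ?S"
      using A sym e Jn x_def by (rule double_sum_krylov)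
    then have "4 dvd ?S"
      using four[of k] by (simp only:)
    \<comment> \<open>For distinct \<open>i\<close> and \<open>j\<close> the length
      \<open>i + j + k\<close> is positive, so the off-diagonal terms are even and only the diagonal
      counts modulo 4.\<close>
    moreover have "2 * 2 dvd ?S - ?T"
      using finJ by (rule dvd_symmetric_double_sum) (auto simp: add.commute intro!: even_w)
    then have "4 dvd ?S - ?T"
      by simp
    ultimately have "4 dvd ?T"
      by (simp only: dvd_diff_right_iff)
    then show ?thesis
      by (simp add: mult_2)
  qed

  define h where "h = (\<lambda>i. if n mod 2 \<le> i then 2 else 1 :: int)"
  define E where "E = mat n n (\<lambda>(i, j). walks A (i + j) div h i)"
  \<comment> \<open>The indicator of the doubled indices \<open>2 * j\<close> with \<open>j\<close>
    in \<open>J\<close>: row \<open>i\<close> of the Gram matrix times \<open>c\<close> is then the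
    sum of \<open>walks A (2 * j + i)\<close>, already known to be divisible by 4.\<close>
  define c where "c = vec n (\<lambda>k. if even k \<and> k div 2 \<in> J then 1 else 0 :: int)"
  have E: "E \<in> carrier_mat n n" and c: "c \<in> carrier_vec n"
    by (auto simp: E_def c_def)
  have hE: "h i * E $$ (i, j) = walks A (i + j)" if "i < n" "j < n" for i j
    using that even_w' by (auto simp: E_def h_def)
  have "transpose_mat ?W * ?W = mat_diag n h * E"
  proof (intro eq_matI)
    fix i j assume "i < dim_row (mat_diag n h * E)" "j < dim_col (mat_diag n h * E)"
    then have ij: "i < n" "j < n" by (auto simp: E_def mat_diag_def)
    have "col ?W k = krylov A e k" if "k < n" for k
      using A ec that by (intro eq_vecI) (auto simp: krylov_mat_def carrier_vecD[OF krylov_carrier[OF A ec]])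
    then have "(transpose_mat ?W * ?W) $$ (i, j) = walks A (i + j)"
      using ij W by (simp add: walks)
    also have "\<dots> = (mat_diag n h * E) $$ (i, j)"
      using ij hE E by (simp add: mat_diag_mult_left[OF E])
    finally show "(transpose_mat ?W * ?W) $$ (i, j) = (mat_diag n h * E) $$ (i, j)" .
  qed (use W E in \<open>auto simp: mat_diag_def\<close>)
  then have "det ?W * det ?W = det (mat_diag n h) * det E"
    using det_mult[of "transpose_mat ?W" n ?W] det_mult[of "mat_diag n h" n E] W E
    by (simp add: det_transpose[OF W])
  moreover have "det (mat_diag n h) = 2 ^ (n div 2) * 2 ^ (n div 2)"
  proof -
    have "det (mat_diag n h) = (\<Prod>k<n. h k)"
      by (subst det_upper_triangular[where n = n])
        (auto simp: mat_diag_def upper_triangular_def prod_list_diag_prod atLeast0LessThan)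
    also have "\<dots> = (\<Prod>k\<in>{n mod 2..<n}. 2)"
      by (intro prod.mono_neutral_cong_right) (auto simp: h_def)
    also have "\<dots> = 2 ^ (n - n mod 2)"
      by simp
    also have "n - n mod 2 = n div 2 + n div 2"
      by presburger
    finally show ?thesis
      by (simp add: power_add)
  qed
  ultimately have detE: "d * d = det E"
    unfolding det by simp
  have "vdvd 2 (E *\<^sub>v c)"
    unfolding vdvd_def
  proof (intro allI impI)
    fix i assume "i < dim_vec (E *\<^sub>v c)"
    then have i: "i < n" using E by simp
    have "h i * (E *\<^sub>v c) $ i = (\<Sum>j<n. h i * E $$ (i, j) * c $ j)"
      using i E c by (simp add: scalar_prod_def atLeast0LessThan sum_distrib_left mult.assoc)
    also have "\<dots> = (\<Sum>j<n. walks A (i + j) * c $ j)"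
      using i by (intro sum.cong) (auto simp: hE)
    also have "\<dots> = (\<Sum>j\<in>(*) 2 ` J. walks A (i + j))"
      using JI I_less by (intro sum.mono_neutral_cong_right) (auto simp: c_def elim!: evenE)
    also have "\<dots> = (\<Sum>j\<in>J. walks A (2 * j + i))"
      by (subst sum.reindex) (auto simp: inj_on_def add.commute)
    finally have "4 dvd h i * (E *\<^sub>v c) $ i"
      using four_sum by simp
    then show "2 dvd (E *\<^sub>v c) $ i"
      by (auto simp: h_def split: if_splits)
  qed
  moreover have "\<not> vdvd 2 c"
  proof -
    obtain j where "j \<in> J"
      using \<open>J \<noteq> {}\<close> by blast
    moreover from this have "2 * j < n"
      using JI I_less by blast
    ultimately show ?thesis
      by (auto simp: vdvd_def c_def intro!: exI[of _ "2 * j"])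
  qed
  ultimately have "even (det E)"
    by (intro prime_dvd_det_if_kernel[OF E c]) auto
  then show ?thesis
    by (simp flip: detE)
qed

section \<open>The generalized spectrum determines the walk numbers\<close>

text \<open>
  Matrix determinant lemma, obtained by multiplying the bordered matrix on the right and on the left
  by block lower triangular matrices.
\<close>

lemma det_add_all_ones:
  fixes M :: "'a :: idom mat"
  assumes M: "M \<in> carrier_mat n n" and nz: "det M \<noteq> 0"
  shows "det (M + mat n n (\<lambda>_. 1)) = det M + vec n (\<lambda>_. 1) \<bullet> (adj_mat M *\<^sub>v vec n (\<lambda>_. 1))"
proof -
  let ?E = "mat n 1 (\<lambda>_. 1) :: 'a mat" and ?F = "mat 1 n (\<lambda>_. 1) :: 'a mat"
  let ?x = "det M" and ?C = "adj_mat M"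
  note adj = adj_mat[OF M]
  let ?s = "vec n (\<lambda>_. 1) \<bullet> (?C *\<^sub>v vec n (\<lambda>_. 1))"
  define P where "P = four_block_mat M (- ?E) ?F (1\<^sub>m 1)"
  define Q where "Q = four_block_mat (1\<^sub>m n) (0\<^sub>m n 1) (- ?F) (1\<^sub>m 1)"
  \<comment> \<open>The adjugate and \<open>det M\<close> replace the inverse of \<open>M\<close>
    and 1, because the entries only lie in an integral domain; the extra power of
    \<open>det M\<close> cancels at the end.\<close>
  define R where "R = four_block_mat ?C (0\<^sub>m n 1) (- (?F * ?C)) (?x \<cdot>\<^sub>m 1\<^sub>m 1)"
  have E: "?E \<in> carrier_mat n 1" "- ?E \<in> carrier_mat n 1" and F: "?F \<in> carrier_mat 1 n" "- ?F \<in> carrier_mat 1 n"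
    by auto
  have FC: "?F * ?C \<in> carrier_mat 1 n" "- (?F * ?C) \<in> carrier_mat 1 n"
    using adj(1) by auto
  have P: "P \<in> carrier_mat (n + 1) (n + 1)" and Q: "Q \<in> carrier_mat (n + 1) (n + 1)"
    and R: "R \<in> carrier_mat (n + 1) (n + 1)"
    unfolding P_def Q_def R_def using M adj(1) by auto
  have "P * Q = four_block_mat (M * 1\<^sub>m n + - ?E * - ?F) (M * 0\<^sub>m n 1 + - ?E * 1\<^sub>m 1)
      (?F * 1\<^sub>m n + 1\<^sub>m 1 * - ?F) (?F * 0\<^sub>m n 1 + 1\<^sub>m 1 * 1\<^sub>m 1)"
    unfolding P_def Q_def using M E F by (intro mult_four_block_mat) auto
  also have "M * 1\<^sub>m n + - ?E * - ?F = M + mat n n (\<lambda>_. 1)"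
    using M by (intro eq_matI) (auto simp: scalar_prod_def)
  also have "M * 0\<^sub>m n 1 + - ?E * 1\<^sub>m 1 = - ?E"
    using M by (intro eq_matI) (auto simp: scalar_prod_def)
  also have "?F * 1\<^sub>m n + 1\<^sub>m 1 * - ?F = 0\<^sub>m 1 n"
    by (intro eq_matI) (auto simp: scalar_prod_def)
  also have "?F * 0\<^sub>m n 1 + 1\<^sub>m 1 * 1\<^sub>m 1 = 1\<^sub>m 1"
    by (intro eq_matI) (auto simp: scalar_prod_def)
  finally have PQ: "P * Q = four_block_mat (M + mat n n (\<lambda>_. 1)) (- ?E) (0\<^sub>m 1 n) (1\<^sub>m 1)" .
  have "det (P * Q) = det (M + mat n n (\<lambda>_. 1))"
    unfolding PQ using M by (subst det_four_block_mat_lower_left_zero[of _ n _ 1]) auto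
  moreover have "det Q = 1"
    unfolding Q_def by (subst det_four_block_mat_upper_right_zero[of _ n _ 1]) auto
  ultimately have detP: "det P = det (M + mat n n (\<lambda>_. 1))"
    using det_mult[OF P Q] by simp

  have "R * P = four_block_mat (?C * M + 0\<^sub>m n 1 * ?F) (?C * - ?E + 0\<^sub>m n 1 * 1\<^sub>m 1)
      (- (?F * ?C) * M + ?x \<cdot>\<^sub>m 1\<^sub>m 1 * ?F) (- (?F * ?C) * - ?E + ?x \<cdot>\<^sub>m 1\<^sub>m 1 * 1\<^sub>m 1)"
    unfolding P_def R_def using M E F FC adj(1) by (intro mult_four_block_mat) auto
  also have "?C * M + 0\<^sub>m n 1 * ?F = ?x \<cdot>\<^sub>m 1\<^sub>m n"
    unfolding adj(3) by (intro eq_matI) auto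
  also have "- (?F * ?C) * M = - (?F * (?C * M))"
  proof -
    have "- (?F * ?C) * M = - (?F * ?C * M)"
      using M adj(1) by (intro uminus_mult_left_mat) auto
    then show ?thesis
      unfolding assoc_mult_mat[OF F(1) adj(1) M] .
  qed
  also have "\<dots> = - (?x \<cdot>\<^sub>m ?F)"
    unfolding adj(3) using F(1) by (simp add: mult_smult_distrib[of _ 1 n _ n])
  also have "- (?x \<cdot>\<^sub>m ?F) + ?x \<cdot>\<^sub>m 1\<^sub>m 1 * ?F = 0\<^sub>m 1 n"
    by (intro eq_matI) (auto simp: scalar_prod_def)
  also have "- (?F * ?C) * - ?E + ?x \<cdot>\<^sub>m 1\<^sub>m 1 * 1\<^sub>m 1 = mat 1 1 (\<lambda>_. ?s + ?x)"
    using adj(1)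
    by (intro eq_matI) (auto simp: scalar_prod_def sum_negf intro: sum.swap)
  finally have RP: "R * P = four_block_mat (?x \<cdot>\<^sub>m 1\<^sub>m n) (?C * - ?E + 0\<^sub>m n 1 * 1\<^sub>m 1) (0\<^sub>m 1 n)
      (mat 1 1 (\<lambda>_. ?s + ?x))" .
  have "det (R * P) = ?x ^ n * (?s + ?x)"
    unfolding RP using adj(1)
    by (subst det_four_block_mat_lower_left_zero[of _ n _ 1]) (auto simp: det_single)
  moreover have "det R = det ?C * ?x"
    unfolding R_def using adj(1) by (subst det_four_block_mat_upper_right_zero[of _ n _ 1]) auto
  moreover have "det ?C * ?x = ?x ^ n"
    using det_mult[OF adj(1) M] unfolding adj(3) by simp
  ultimately have "?x ^ n * det P = ?x ^ n * (?s + ?x)"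
    using det_mult[OF R P] by simp
  then show ?thesis
    using nz detP by simp
qed

section \<open>Resolvent polynomials and walk numbers\<close>

lemma const_poly_sum: "[:\<Sum>i\<in>S. f i:] = (\<Sum>i\<in>S. [:f i:])"
proof (induction S rule: infinite_finite_induct)
  case (insert x F)
  have "[:f x + sum f F:] = [:f x:] + [:sum f F:]"
    by simp
  with insert show ?case
    by simp
qed auto

lemma char_poly_matrix_nth:
  assumes "A \<in> carrier_mat n n" "i < n" "j < n"
  shows "char_poly_matrix A $$ (i, j) = (if i = j then [:0, 1:] else 0) - [:A $$ (i, j):]"
  using assms by (auto simp: char_poly_matrix_def)

text \<open>
  \<open>resolvent_krylov A k\<close> is \<open>det (x - A)\<close> times \<open>e \<bullet> A\<^sup>k (x - A)\<^sup>-\<^sup>1 e\<close>, where \<open>e\<close> is the all-ones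
  vector.
\<close>

definition resolvent_krylov :: "'a :: comm_ring_1 mat \<Rightarrow> nat \<Rightarrow> 'a poly" where
  "resolvent_krylov A k = (\<Sum>i<dim_row A. [:krylov A (vec (dim_row A) (\<lambda>_. 1)) k $ i:]
     * (adj_mat (char_poly_matrix A) *\<^sub>v vec (dim_row A) (\<lambda>_. 1)) $ i)"

text \<open>Row \<open>i\<close> of the adjugate identity \<open>(x - A) v = char_poly A e\<close>,
  solved for \<open>x v\<close>.\<close>

lemma resolvent_vec_eq:
  fixes A :: "'a :: idom mat"
  assumes A: "A \<in> carrier_mat n n"
  defines "v \<equiv> adj_mat (char_poly_matrix A) *\<^sub>v vec n (\<lambda>_. 1)"
  assumes i: "i < n"
  shows "[:0, 1:] * v $ i = (\<Sum>j<n. [:A $$ (i, j):] * v $ j) + char_poly A"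
proof -
  let ?M = "char_poly_matrix A"
  have M: "?M \<in> carrier_mat n n"
    using A by simp
  note adj = adj_mat[OF M]
  have v: "v \<in> carrier_vec n"
    unfolding v_def using adj(1) by (intro mult_mat_vec_carrier) auto
  have "?M *\<^sub>v v = (?M * adj_mat ?M) *\<^sub>v vec n (\<lambda>_. 1)"
    unfolding v_def using M adj(1) by (intro assoc_mult_mat_vec[symmetric]) auto
  also have "\<dots> = char_poly A \<cdot>\<^sub>v vec n (\<lambda>_. 1)"
    unfolding adj(2) char_poly_def[symmetric] by (simp add: smult_mat_mult_mat_vec)
  finally have "char_poly A = (?M *\<^sub>v v) $ i"
    using i by simp
  also have "\<dots> = (\<Sum>j<n. ((if i = j then [:0, 1:] else 0) - [:A $$ (i, j):]) * v $ j)"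
  proof -
    have "(?M *\<^sub>v v) $ i = (\<Sum>j<n. ?M $$ (i, j) * v $ j)"
      using i M v by (simp add: scalar_prod_def atLeast0LessThan)
    then show ?thesis
      using i by (simp add: char_poly_matrix_nth[OF A])
  qed
  also have "\<dots> = (\<Sum>j<n. (if i = j then [:0, 1:] * v $ j else 0) - [:A $$ (i, j):] * v $ j)"
    by (intro sum.cong) (auto simp: left_diff_distrib)
  also have "\<dots> = [:0, 1:] * v $ i - (\<Sum>j<n. [:A $$ (i, j):] * v $ j)"
    using i by (simp add: sum_subtractf)
  finally show ?thesis
    by (simp add: algebra_simps)
qed

text \<open>No cofactor is expanded: for a nonzero entry of maximal degree \<open>D\<close>,
  \<open>resolvent_vec_eq\<close> has degree \<open>D + 1\<close> on the left and at most
  \<open>max D n\<close> on the right.\<close>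

lemma degree_resolvent_vec_less:
  fixes A :: "'a :: idom mat"
  assumes A: "A \<in> carrier_mat n n" and i: "i < n"
  shows "degree ((adj_mat (char_poly_matrix A) *\<^sub>v vec n (\<lambda>_. 1)) $ i) < n"
proof -
  define v where "v = adj_mat (char_poly_matrix A) *\<^sub>v vec n (\<lambda>_. 1)"
  define D where "D = Max ((\<lambda>i. degree (v $ i)) ` {..<n})"
  have D: "degree (v $ j) \<le> D" if "j < n" for j
    unfolding D_def using that by (intro Max_ge) auto
  have "D \<in> (\<lambda>i. degree (v $ i)) ` {..<n}"
    unfolding D_def using i by (intro Max_in) auto
  then obtain m where m: "m < n" "degree (v $ m) = D"
    by auto
  have "D < n"
  proof (cases "v $ m = 0")
    case True
    with m i show ?thesis by auto
  next
    case False
    then have "Suc D = degree ([:0, 1:] * v $ m)"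
      using m by (subst degree_mult_eq) auto
    also have "\<dots> = degree ((\<Sum>j<n. [:A $$ (m, j):] * v $ j) + char_poly A)"
      using resolvent_vec_eq[OF A m(1)] by (simp add: v_def)
    also have "\<dots> \<le> max D n"
    proof (rule degree_add_le)
      show "degree (\<Sum>j<n. [:A $$ (m, j):] * v $ j) \<le> max D n"
        using D by (intro degree_sum_le) (auto intro!: order.trans[OF degree_smult_le] simp: le_max_iff_disj)
      show "degree (char_poly A) \<le> max D n"
        using degree_monic_char_poly[OF A] by simp
    qed
    finally show ?thesis
      by simp
  qed
  then show ?thesis
    using D[OF i] by (simp add: v_def)
qed

text \<open>This is \<open>x (x - A)^-1 = A (x - A)^-1 + 1\<close> with denominators cleared, paired
  with \<open>A^k e\<close>; symmetry of \<open>A\<close> moves the factor \<open>A\<close> onto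
  \<open>A^k e\<close>.\<close>

lemma resolvent_krylov_Suc:
  fixes A :: "'a :: idom mat"
  assumes A: "A \<in> carrier_mat n n" and sym: "transpose_mat A = A"
  shows "[:0, 1:] * resolvent_krylov A k = resolvent_krylov A (Suc k) + char_poly A * [:walks A k:]"
proof -
  define e where "e = (vec n (\<lambda>_. 1) :: 'a vec)"
  define v where "v = adj_mat (char_poly_matrix A) *\<^sub>v vec n (\<lambda>_. 1)"
  have e: "e \<in> carrier_vec n" by (simp add: e_def)
  have A_sym: "A $$ (i, j) = A $$ (j, i)" if "i < n" "j < n" for i j
    using that A by (subst sym[symmetric]) simp
  have dims: "dim_row A = n" using A by simp
  have Suc: "[:krylov A e (Suc k) $ j:] = (\<Sum>i<n. [:krylov A e k $ i:] * [:A $$ (i, j):])" if "j < n" for j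
  proof -
    have "krylov A e (Suc k) $ j = (\<Sum>i<n. krylov A e k $ i * A $$ (i, j))"
      using A that carrier_vecD[OF krylov_carrier[OF A e, of k]]
      by (auto simp: krylov_Suc scalar_prod_def atLeast0LessThan mult.commute A_sym[OF that] intro!: sum.cong)
    then show ?thesis
      by (simp add: const_poly_sum mult.commute)
  qed
  have walks: "(\<Sum>i<n. [:krylov A e k $ i:]) = [:walks A k:]"
    using carrier_vecD[OF krylov_carrier[OF A e, of k]]
    by (simp add: walks_def dims scalar_prod_def atLeast0LessThan const_poly_sum flip: e_def)
      (simp add: e_def)
  have "[:0, 1:] * resolvent_krylov A k = (\<Sum>i<n. [:krylov A e k $ i:] * ([:0, 1:] * v $ i))"
    by (simp add: resolvent_krylov_def dims sum_distrib_left mult.left_commute flip: e_def v_def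
        del: mult_pCons_left mult_pCons_right)
  also have "\<dots> = (\<Sum>i<n. [:krylov A e k $ i:] * ((\<Sum>j<n. [:A $$ (i, j):] * v $ j) + char_poly A))"
    using resolvent_vec_eq[OF A] by (intro sum.cong) (auto simp: v_def simp del: mult_pCons_left mult_pCons_right)
  also have "\<dots> = (\<Sum>i<n. \<Sum>j<n. [:krylov A e k $ i:] * [:A $$ (i, j):] * v $ j)
      + (\<Sum>i<n. [:krylov A e k $ i:]) * char_poly A"
    unfolding distrib_left sum.distrib sum_distrib_left sum_distrib_right mult.assoc ..
  also have "(\<Sum>i<n. \<Sum>j<n. [:krylov A e k $ i:] * [:A $$ (i, j):] * v $ j)
      = (\<Sum>j<n. (\<Sum>i<n. [:krylov A e k $ i:] * [:A $$ (i, j):]) * v $ j)"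
    unfolding sum_distrib_right by (rule sum.swap)
  also have "\<dots> = resolvent_krylov A (Suc k)"
    unfolding resolvent_krylov_def dims e_def[symmetric] v_def[symmetric]
    by (intro sum.cong refl) (simp only: lessThan_iff Suc)
  finally show ?thesis
    unfolding walks by (simp only: mult.commute)
qed

lemma degree_resolvent_krylov_less:
  fixes A :: "'a :: idom mat"
  assumes A: "A \<in> carrier_mat n n" and "n > 0"
  shows "degree (resolvent_krylov A k) < n"
proof -
  have "degree (resolvent_krylov A k) \<le> n - 1"
    unfolding resolvent_krylov_def
  proof (rule degree_sum_le)
    fix i assume "i \<in> {..<dim_row A}"
    then show "degree ([:krylov A (vec (dim_row A) (\<lambda>_. 1)) k $ i:]
        * (adj_mat (char_poly_matrix A) *\<^sub>v vec (dim_row A) (\<lambda>_. 1)) $ i) \<le> n - 1"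
      using degree_resolvent_vec_less[OF A, of i] A by (auto intro!: order.trans[OF degree_smult_le])
  qed simp
  then show ?thesis
    using \<open>n > 0\<close> by simp
qed

text \<open>The recurrence is a division with remainder by the monic \<open>char_poly A\<close>:
  \<open>walks A k\<close> is the quotient and the next resolvent polynomial, of degree below
  \<open>n\<close>, the remainder. Both are determined by the current one.\<close>

lemma walks_eq_if_resolvent_eq:
  fixes A B :: "'a :: idom mat"
  assumes A: "A \<in> carrier_mat n n" "transpose_mat A = A" and B: "B \<in> carrier_mat n n" "transpose_mat B = B"
    and "n > 0" and char_poly: "char_poly A = char_poly B"
    and resolvent: "resolvent_krylov A 0 = resolvent_krylov B 0"
  shows "walks A k = walks B k"
proof -
  have step: "walks A k = walks B k \<and> resolvent_krylov A (Suc k) = resolvent_krylov B (Suc k)"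
    if "resolvent_krylov A k = resolvent_krylov B k" for k
  proof -
    have eq: "char_poly A * [:walks A k - walks B k:] = resolvent_krylov B (Suc k) - resolvent_krylov A (Suc k)"
      using resolvent_krylov_Suc[OF A, of k] resolvent_krylov_Suc[OF B, of k] that char_poly
      by (simp add: algebra_simps smult_diff_left)
    have "degree (char_poly A * [:walks A k - walks B k:]) < n"
      unfolding eq using degree_resolvent_krylov_less A B \<open>n > 0\<close> by (blast intro: degree_diff_less)
    then have "walks A k - walks B k = 0"
      using degree_monic_char_poly[OF A(1)] by (auto simp: mult.commute[of "char_poly A"] split: if_splits)
    with eq show ?thesis by simp
  qed
  have "resolvent_krylov A k = resolvent_krylov B k"
    by (induction k) (use step resolvent in auto)
  then show ?thesis
    using step by blast
qed

text \<open>Let J be the all-ones matrix and \<open>C = J - I - A\<close>, the form of the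
  complement's adjacency matrix. Then \<open>x - A + J\<close> is minus
  \<open>(- 1 - x) - C\<close>, which explains the substitution and the sign;
  \<open>det_add_all_ones\<close> evaluates its determinant.\<close>

lemma resolvent_krylov_0_eq:
  fixes A :: "'a :: idom mat"
  assumes A: "A \<in> carrier_mat n n"
  shows "resolvent_krylov A 0 = (- 1) ^ n * (char_poly (mat n n (\<lambda>(i, j). (if i = j then 0 else 1)) - A) \<circ>\<^sub>p [:- 1, - 1:])
    - char_poly A"
proof -
  let ?C = "mat n n (\<lambda>(i, j). (if i = j then 0 else 1)) - A"
  have C: "?C \<in> carrier_mat n n" and M: "char_poly_matrix A \<in> carrier_mat n n"
    using A by auto
  have "degree (char_poly A) = n" "coeff (char_poly A) n = 1"
    using degree_monic_char_poly[OF A] by auto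
  then have "det (char_poly_matrix A) \<noteq> 0"
    unfolding char_poly_def by auto
  note det_add_all_ones[OF M this]
  also have "vec n (\<lambda>_. 1) \<bullet> (adj_mat (char_poly_matrix A) *\<^sub>v vec n (\<lambda>_. 1)) = resolvent_krylov A 0"
    using A adj_mat(1)[OF M] by (simp add: resolvent_krylov_def scalar_prod_def[of "vec n (\<lambda>_. 1)"]
        atLeast0LessThan flip: one_pCons)
  also have "char_poly_matrix A + mat n n (\<lambda>_. 1) = (- 1) \<cdot>\<^sub>m map_mat (\<lambda>p. p \<circ>\<^sub>p [:- 1, - 1:]) (char_poly_matrix ?C)"
  proof (intro eq_matI)
    fix i j
    assume "i < dim_row ((- 1) \<cdot>\<^sub>m map_mat (\<lambda>p. p \<circ>\<^sub>p [:- 1, - 1:]) (char_poly_matrix ?C))"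
      and "j < dim_col ((- 1) \<cdot>\<^sub>m map_mat (\<lambda>p. p \<circ>\<^sub>p [:- 1, - 1:]) (char_poly_matrix ?C))"
    then have ij: "i < n" "j < n"
      using carrier_matD[OF char_poly_matrix_closed[OF C]] by auto
    then show "(char_poly_matrix A + mat n n (\<lambda>_. 1)) $$ (i, j)
        = ((- 1) \<cdot>\<^sub>m map_mat (\<lambda>p. p \<circ>\<^sub>p [:- 1, - 1:]) (char_poly_matrix ?C)) $$ (i, j)"
      using A carrier_matD[OF char_poly_matrix_closed[OF C]] carrier_matD[OF M]
      by (auto simp: char_poly_matrix_nth[OF A] char_poly_matrix_nth[OF C] pcompose_pCons pcompose_diff one_pCons)
  qed (use carrier_matD[OF char_poly_matrix_closed[OF C]] in auto)
  also have "det \<dots> = (- 1) ^ n * (char_poly ?C \<circ>\<^sub>p [:- 1, - 1:])"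
    using char_poly_matrix_closed[OF C] by (simp add: comm_ring_hom.hom_det[OF pcompose_hom.comm_ring_hom_axioms] char_poly_def)
  finally show ?thesis
    by (simp add: char_poly_def algebra_simps)
qed

section \<open>The rational orthogonal matrix relating two walk matrices\<close>

lemma mult_mat_vec_cancel:
  fixes M :: "'a :: idom mat"
  assumes "M \<in> carrier_mat n n" "x \<in> carrier_vec n" "y \<in> carrier_vec n"
    and "M *\<^sub>v x = M *\<^sub>v y" and "det M \<noteq> 0"
  shows "x = y"
proof (intro eq_vecI)
  have "det M \<cdot>\<^sub>v x = det M \<cdot>\<^sub>v y"
    using assms by (metis adj_mat_mult_mat_vec)
  then have "(det M \<cdot>\<^sub>v x) $ i = (det M \<cdot>\<^sub>v y) $ i" for i
    by (simp only:)
  then have "det M * x $ i = det M * y $ i" if "i < n" for i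
    using that assms by (metis carrier_vecD index_smult_vec(1))
  then show "x $ i = y $ i" if "i < dim_vec y" for i
    using that assms by simp
qed (use assms in auto)

lemma mat_cancel_left:
  fixes M :: "'a :: idom mat"
  assumes M: "M \<in> carrier_mat n n" and X: "X \<in> carrier_mat n m" and Y: "Y \<in> carrier_mat n m"
    and eq: "M * X = M * Y" and nz: "det M \<noteq> 0"
  shows "X = Y"
proof (intro eq_matI)
  note adj = adj_mat[OF M]
  have "det M \<cdot>\<^sub>m Z = adj_mat M * (M * Z)" if "Z \<in> carrier_mat n m" for Z
  proof -
    have "adj_mat M * (M * Z) = (det M \<cdot>\<^sub>m 1\<^sub>m n) * Z"
      using assoc_mult_mat[OF adj(1) M that] adj(3) by simp
    also have "\<dots> = det M \<cdot>\<^sub>m Z"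
      using that by (simp add: mult_smult_assoc_mat[OF one_carrier_mat that])
    finally show ?thesis ..
  qed
  then have "det M \<cdot>\<^sub>m X = det M \<cdot>\<^sub>m Y"
    using X Y eq by simp
  then have "(det M \<cdot>\<^sub>m X) $$ (i, j) = (det M \<cdot>\<^sub>m Y) $$ (i, j)" for i j
    by (simp only:)
  then have "det M * X $$ (i, j) = det M * Y $$ (i, j)" if "i < n" "j < m" for i j
    using that X Y by (metis carrier_matD index_smult_mat(1))
  then show "X $$ (i, j) = Y $$ (i, j)" if "i < dim_row Y" "j < dim_col Y" for i j
    using that Y nz by simp
qed (use X Y in auto)

lemma mat_cancel_right:
  fixes M :: "'a :: idom mat"
  assumes M: "M \<in> carrier_mat n n" and X: "X \<in> carrier_mat m n" and Y: "Y \<in> carrier_mat m n"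
    and eq: "X * M = Y * M" and nz: "det M \<noteq> 0"
  shows "X = Y"
proof -
  have "transpose_mat M * transpose_mat X = transpose_mat M * transpose_mat Y"
    using eq transpose_mult[OF X M] transpose_mult[OF Y M] by simp
  then have "transpose_mat X = transpose_mat Y"
    using M X Y nz by (subst mat_cancel_left[of "transpose_mat M" n "transpose_mat X" m "transpose_mat Y"]) (auto simp: det_transpose)
  then show ?thesis
    by (metis transpose_transpose)
qed

lemma col_krylov_mat:
  assumes A: "A \<in> carrier_mat n n" and v: "v \<in> carrier_vec n" and k: "k < n"
  shows "col (krylov_mat A v) k = krylov A v k"
  using A k by (intro eq_vecI) (auto simp: krylov_mat_def carrier_vecD[OF krylov_carrier[OF A v]])

lemma mat_eq_by_cols:
  assumes "X \<in> carrier_mat n m" "Y \<in> carrier_mat n m" "\<And>j. j < m \<Longrightarrow> col X j = col Y j"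
  shows "X = Y"
  using assms by (intro mat_col_eqI) auto

section \<open>The level of the matrix relating two walk matrices\<close>

locale equal_walks =
  fixes n :: nat and A B :: "int mat" and e :: "int vec"
  assumes A: "A \<in> carrier_mat n n" and symA: "transpose_mat A = A"
    and B: "B \<in> carrier_mat n n" and symB: "transpose_mat B = B"
    and e_def: "e = vec n (\<lambda>_. 1)"
    and walks_eq: "walks A k = walks B k"
    and det_nz: "det (krylov_mat A e) \<noteq> 0"
begin

abbreviation "W \<equiv> krylov_mat A e"
abbreviation "V \<equiv> krylov_mat B e"

lemma e: "e \<in> carrier_vec n"
  by (simp add: e_def)

lemma W: "W \<in> carrier_mat n n" and V: "V \<in> carrier_mat n n"
  using A B by auto

lemma krylov_dot_A: "krylov A e i \<bullet> krylov A e j = walks A (i + j)"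
  using krylov_scalar_prod_krylov[OF A symA e e] A by (simp add: walks_def e_def)

lemma krylov_dot_B: "krylov B e i \<bullet> krylov B e j = walks A (i + j)"
  using krylov_scalar_prod_krylov[OF B symB e e] B by (simp add: walks_eq) (simp add: walks_def e_def)

lemma gram_eq: "transpose_mat W * W = transpose_mat V * V"
  using W V
  by (intro eq_matI) (auto simp: col_krylov_mat[OF A e] col_krylov_mat[OF B e] krylov_dot_A krylov_dot_B)

lemma det_V_nz: "det V \<noteq> 0"
proof -
  have "det W * det W = det V * det V"
    using det_mult[of "transpose_mat W" n W] det_mult[of "transpose_mat V" n V] W V gram_eq
    by (simp add: det_transpose)
  with det_nz show ?thesis by auto
qed

text \<open>
  \<open>is_level l U\<close> says that \<open>U / l\<close> is the rational matrix \<open>W V\<^sup>-\<^sup>1\<close>; the least such \<open>l\<close> is its level.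
\<close>

definition is_level :: "nat \<Rightarrow> int mat \<Rightarrow> bool" where
  "is_level l U \<longleftrightarrow> l > 0 \<and> U \<in> carrier_mat n n \<and> U * V = int l \<cdot>\<^sub>m W"

lemma is_level_exists: "\<exists>l U. is_level l U"
proof -
  note adj = adj_mat[OF V]
  \<comment> \<open>The sign turns the multiplier \<open>det V\<close> into its absolute value, as a
    level has to be positive.\<close>
  define U where "U = sgn (det V) \<cdot>\<^sub>m (W * adj_mat V)"
  have U: "U \<in> carrier_mat n n"
    using W adj(1) by (simp add: U_def)
  have "U * V = sgn (det V) \<cdot>\<^sub>m (W * (adj_mat V * V))"
    unfolding U_def using W V adj(1) by (simp add: mult_smult_assoc_mat[of _ n n _ n])
  also have "\<dots> = (sgn (det V) * det V) \<cdot>\<^sub>m W"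
    unfolding adj(3) using W by (intro eq_matI) (auto simp: mult_smult_distrib[of _ n n _ n])
  also have "sgn (det V) * det V = int (nat \<bar>det V\<bar>)"
    by (simp add: sgn_if)
  finally have "is_level (nat \<bar>det V\<bar>) U"
    unfolding is_level_def using U det_V_nz by simp
  then show ?thesis by blast
qed

context
  fixes l U
  assumes level: "is_level l U"
begin

lemma U: "U \<in> carrier_mat n n" and UV: "U * V = int l \<cdot>\<^sub>m W" and l_pos: "l > 0"
  using level by (auto simp: is_level_def)

lemma U_krylov: "k < n \<Longrightarrow> U *\<^sub>v krylov B e k = int l \<cdot>\<^sub>v krylov A e k"
proof -
  assume k: "k < n"
  have "U *\<^sub>v krylov B e k = col (U * V) k"
    using U V k by (subst col_mult2[of _ n n _ n]) (auto simp: col_krylov_mat[OF B e])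
  also have "\<dots> = int l \<cdot>\<^sub>v krylov A e k"
    unfolding UV using W k by (simp add: col_smult col_krylov_mat[OF A e])
  finally show ?thesis .
qed

text \<open>This reaches beyond the columns of the walk matrices: both sides are paired with the
  columns \<open>B^i e\<close> of the nonsingular \<open>V\<close>, and the pairings are walk
  numbers for every exponent \<open>k\<close>.\<close>

lemma UT_krylov: "transpose_mat U *\<^sub>v krylov A e k = int l \<cdot>\<^sub>v krylov B e k"
proof -
  let ?x = "transpose_mat U *\<^sub>v krylov A e k" and ?y = "int l \<cdot>\<^sub>v krylov B e k"
  have x: "?x \<in> carrier_vec n" and y: "?y \<in> carrier_vec n"
    using U A B e by (auto intro!: mult_mat_vec_carrier)
  have KA: "krylov A e i \<in> carrier_vec n" and KB: "krylov B e i \<in> carrier_vec n" for i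
    using A B e by auto
  have col: "krylov B e i \<bullet> ?x = krylov B e i \<bullet> ?y" if "i < n" for i
  proof -
    have "krylov B e i \<bullet> ?x = ?x \<bullet> krylov B e i"
      using KB x by (rule comm_scalar_prod)
    also have "\<dots> = krylov A e k \<bullet> (U *\<^sub>v krylov B e i)"
      using U KB KA by (rule transpose_vec_mult_scalar)
    also have "\<dots> = int l * walks A (k + i)"
      using U_krylov[OF that] carrier_vecD[OF KA] by (simp add: krylov_dot_A)
    also have "\<dots> = krylov B e i \<bullet> ?y"
      using carrier_vecD[OF KB] by (simp add: krylov_dot_B add.commute)
    finally show ?thesis .
  qed
  have "transpose_mat V *\<^sub>v ?x = transpose_mat V *\<^sub>v ?y"
    using V col by (intro eq_vecI) (auto simp: col_krylov_mat[OF B e] simp del: scalar_prod_smult_right)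
  then show ?thesis
    using V x y det_V_nz by (subst mult_mat_vec_cancel[of "transpose_mat V" n ?x ?y]) (auto simp: det_transpose)
qed

lemma UT: "transpose_mat U \<in> carrier_mat n n"
  using U by simp

lemma UT_W: "transpose_mat U * W = int l \<cdot>\<^sub>m V"
proof (rule mat_eq_by_cols)
  fix k assume k: "k < n"
  have "col (transpose_mat U * W) k = transpose_mat U *\<^sub>v krylov A e k"
    using UT W k by (subst col_mult2[of _ n n _ n]) (auto simp: col_krylov_mat[OF A e])
  also have "\<dots> = col (int l \<cdot>\<^sub>m V) k"
    using V k by (simp add: UT_krylov col_smult col_krylov_mat[OF B e])
  finally show "col (transpose_mat U * W) k = col (int l \<cdot>\<^sub>m V) k" .
qed (use UT W V in auto)

lemma UT_U: "transpose_mat U * U = int (l * l) \<cdot>\<^sub>m 1\<^sub>m n"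
proof (rule mat_cancel_right[OF V _ _ _ det_V_nz])
  have "transpose_mat U * U * V = transpose_mat U * (int l \<cdot>\<^sub>m W)"
    using UT U V UV by simp
  also have "\<dots> = int l \<cdot>\<^sub>m (int l \<cdot>\<^sub>m V)"
    using UT W by (simp add: mult_smult_distrib[of _ n n _ n] UT_W)
  also have "\<dots> = int (l * l) \<cdot>\<^sub>m 1\<^sub>m n * V"
    using V by (simp add: mult_smult_assoc_mat[of _ n n _ n]) (intro eq_matI, auto)
  finally show "transpose_mat U * U * V = int (l * l) \<cdot>\<^sub>m 1\<^sub>m n * V" .
qed (use UT U in auto)

text \<open>Both sides send \<open>A^k e\<close> to \<open>l\<close> times
  \<open>B^(k + 1) e\<close>; for the last column this uses \<open>UT_krylov\<close> at exponent
  \<open>n\<close>.\<close>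

lemma UT_A: "transpose_mat U * A = B * transpose_mat U"
proof (rule mat_cancel_right[OF W _ _ _ det_nz])
  show "transpose_mat U * A * W = B * transpose_mat U * W"
  proof (rule mat_eq_by_cols[of _ n n])
    fix k assume k: "k < n"
    have KA: "krylov A e i \<in> carrier_vec n" and KB: "krylov B e i \<in> carrier_vec n" for i
      using A B e by auto
    have "col (transpose_mat U * A * W) k = transpose_mat U * A *\<^sub>v krylov A e k"
      using UT A W k by (subst col_mult2[of _ n n _ n]) (auto simp: col_krylov_mat[OF A e])
    also have "\<dots> = transpose_mat U *\<^sub>v krylov A e (Suc k)"
      using UT A KA by (simp add: krylov_Suc)
    also have "\<dots> = B *\<^sub>v (int l \<cdot>\<^sub>v krylov B e k)"
      unfolding UT_krylov krylov_Suc[of B] using B carrier_vecD[OF KB]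
      by (simp add: mult_mat_vec_smult)
    also have "\<dots> = B * transpose_mat U *\<^sub>v krylov A e k"
      using UT B KA by (simp add: UT_krylov)
    also have "\<dots> = col (B * transpose_mat U * W) k"
      using UT B W k by (subst col_mult2[of _ n n _ n]) (auto simp: col_krylov_mat[OF A e])
    finally show "col (transpose_mat U * A * W) k = col (B * transpose_mat U * W) k" .
  qed (meson mult_carrier_mat UT A B W)+
qed (use UT A B in auto)

lemma UT_krylov_general:
  assumes u: "u \<in> carrier_vec n"
  shows "transpose_mat U *\<^sub>v krylov A u k = krylov B (transpose_mat U *\<^sub>v u) k"
proof (induction k)
  case (Suc k)
  have "krylov A u k \<in> carrier_vec n"
    using A u by simp
  then have "transpose_mat U *\<^sub>v krylov A u (Suc k) = B *\<^sub>v (transpose_mat U *\<^sub>v krylov A u k)"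
    unfolding krylov_Suc using assoc_mult_mat_vec[OF UT A] assoc_mult_mat_vec[OF B UT] UT_A by metis
  then show ?case
    by (simp add: krylov_Suc Suc)
qed simp

text \<open>Entry \<open>j\<close> of \<open>U^T A^k e = l B^k e\<close>, and diagonal entry
  \<open>j\<close> of \<open>U^T A^k U = l^2 B^k\<close>. For a prime dividing \<open>l\<close>
  these supply the divisibility hypotheses of both results on \<open>det W\<close>.\<close>

lemma col_U_krylov:
  assumes j: "j < n"
  shows "int l dvd col U j \<bullet> krylov A e k"
    and "int (l * l) dvd col U j \<bullet> krylov A (col U j) k"
proof -
  have c: "col U j \<in> carrier_vec n"
    using U j by auto
  have "col U j \<bullet> krylov A e k = (transpose_mat U *\<^sub>v krylov A e k) $ j"
    using U j by simp
  also have "\<dots> = int l * krylov B e k $ j"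
    using j B e by (simp add: UT_krylov carrier_vecD[OF krylov_carrier[OF B e]])
  finally show "int l dvd col U j \<bullet> krylov A e k"
    by simp
  have "transpose_mat U *\<^sub>v col U j = col (transpose_mat U * U) j"
    using UT U j by (subst col_mult2[of _ n n _ n]) auto
  also have "\<dots> = int (l * l) \<cdot>\<^sub>v unit_vec n j"
    unfolding UT_U using j by (intro eq_vecI) (auto simp: unit_vec_def)
  finally have Uc: "transpose_mat U *\<^sub>v col U j = int (l * l) \<cdot>\<^sub>v unit_vec n j" .
  have "col U j \<bullet> krylov A (col U j) k = (transpose_mat U *\<^sub>v krylov A (col U j) k) $ j"
    using U j by simp
  also have "\<dots> = krylov B (int (l * l) \<cdot>\<^sub>v unit_vec n j) k $ j"
    by (simp add: UT_krylov_general[OF c] Uc)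
  also have "krylov B (int (l * l) \<cdot>\<^sub>v unit_vec n j) k = int (l * l) \<cdot>\<^sub>v krylov B (unit_vec n j) k"
    using B by (rule krylov_smult) simp
  finally show "int (l * l) dvd col U j \<bullet> krylov A (col U j) k"
    using j carrier_vecD[OF krylov_carrier[OF B unit_vec_carrier], of j k] by simp
qed

lemma level_reducible:
  assumes p: "prime p" "p dvd l" and cols: "\<And>j. j < n \<Longrightarrow> vdvd (int p) (col U j)"
  shows "\<exists>U'. is_level (l div p) U'"
proof -
  define U' where "U' = map_mat (\<lambda>x. x div int p) U"
  have U': "U' \<in> carrier_mat n n"
    using U by (simp add: U'_def)
  have "U = int p \<cdot>\<^sub>m U'"
    using cols U by (intro eq_matI) (auto simp: U'_def vdvd_def)
  moreover have l: "l = p * (l div p)"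
    using p by simp
  ultimately have eq: "int p \<cdot>\<^sub>m (U' * V) = int (p * (l div p)) \<cdot>\<^sub>m W"
    using UV mult_smult_assoc_mat[OF U' V, of "int p"] by simp
  have "p > 0"
    using p by (simp add: prime_gt_0_nat)
  have "U' * V = int (l div p) \<cdot>\<^sub>m W"
  proof (intro eq_matI)
    fix i j assume "i < dim_row (int (l div p) \<cdot>\<^sub>m W)" "j < dim_col (int (l div p) \<cdot>\<^sub>m W)"
    then have ij: "i < n" "j < n"
      using W by auto
    have "(int p \<cdot>\<^sub>m (U' * V)) $$ (i, j) = (int (p * (l div p)) \<cdot>\<^sub>m W) $$ (i, j)"
      unfolding eq ..
    then have "int p * (U' * V) $$ (i, j) = int p * (int (l div p) * W $$ (i, j))"
      using ij U' V W by (simp del: index_mult_mat add: index_mult_mat(2,3) of_nat_mult flip: zdiv_int)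
    then show "(U' * V) $$ (i, j) = (int (l div p) \<cdot>\<^sub>m W) $$ (i, j)"
      using ij W \<open>p > 0\<close> by (simp del: index_mult_mat)
  qed (use U' V W in auto)
  moreover have "l div p > 0"
    using l l_pos by (cases "l div p") auto
  ultimately show ?thesis
    using U' by (auto simp: is_level_def)
qed

end

lemma level_one_exists:
  assumes diag: "\<And>i. i < n \<Longrightarrow> A $$ (i, i) = 0"
    and det: "det W = 2 ^ (n div 2) * d" and "odd d" and "squarefree d"
  shows "\<exists>U. is_level 1 U"
proof -
  define l where "l = (LEAST l. \<exists>U. is_level l U)"
  have "\<exists>U. is_level l U"
    unfolding l_def by (rule LeastI_ex[OF is_level_exists])
  then obtain U where level: "is_level l U"
    by blast
  have minimal: "l \<le> l'" if "is_level l' U'" for l' U'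
    unfolding l_def using that by (intro Least_le) blast
  have "l = 1"
  proof (rule ccontr)
    assume "l \<noteq> 1"
    then obtain p where p: "prime p" "p dvd l"
      using prime_factor_nat by blast
    have "l div p < l"
      using p l_pos[OF level] prime_gt_1_nat by (intro div_less_dividend) auto
    \<comment> \<open>Minimality of \<open>l\<close>: if \<open>p\<close> divided every column of
      \<open>U\<close>, it could be cancelled from \<open>U\<close> and \<open>l\<close>.\<close>
    then obtain j where j: "j < n" "\<not> vdvd (int p) (col U j)"
      using level_reducible[OF level p] minimal by (meson not_le)
    define u where "u = col U j"
    have u: "u \<in> carrier_vec n"
      using U[OF level] j by (auto simp: u_def)
    have p': "prime (int p)" "int p dvd int l" "(int p)\<^sup>2 dvd int (l * l)"
      using p by (auto simp: power2_eq_square mult_dvd_mono)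
    have u1: "int p dvd u \<bullet> krylov A e k" for k
      using col_U_krylov(1)[OF level j(1), of k] p'(2) unfolding u_def by (rule dvd_trans[rotated])
    have u2: "(int p)\<^sup>2 dvd u \<bullet> krylov A u k" for k
      using col_U_krylov(2)[OF level j(1), of k] p'(3) unfolding u_def by (rule dvd_trans[rotated])
    show False
    proof (cases "p = 2")
      case True
      then have "even d"
        using even_det_krylov_mat_quotient[OF A symA diag e_def u _ _ _ det] u1 u2 j(2) by (simp add: u_def)
      with \<open>odd d\<close> show False ..
    next
      case False
      have "(int p)\<^sup>2 dvd det W"
        using square_dvd_det_krylov_mat[OF A symA e u p'(1) _ u1] u2[of 0] u2[of 1] j(2)
        by (simp add: u_def krylov_Suc)
      moreover have "coprime ((int p)\<^sup>2) (2 ^ (n div 2))"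
      proof -
        have "odd p"
          using False p(1) prime_ge_2_nat[of p] prime_odd_nat[of p] by linarith
        then show ?thesis
          by simp
      qed
      ultimately have "(int p)\<^sup>2 dvd d"
        unfolding det by (simp add: coprime_dvd_mult_right_iff)
      with \<open>squarefree d\<close> have "is_unit (int p)"
        by (rule squarefreeD)
      with p'(1) show False
        by auto
    qed
  qed
  with level show ?thesis
    by blast
qed

text \<open>A column of \<open>U\<close> has integer entries with sum 1 and sum of squares 1. As
  \<open>x * x - x\<close> is nonnegative on integers, all entries are 0 or 1, hence exactly one is
  1.\<close>

lemma permutation_of_level_one:
  assumes level: "is_level 1 U"
  obtains \<sigma> where "bij_betw \<sigma> {0..<n} {0..<n}"
    "\<And>i j. i < n \<Longrightarrow> j < n \<Longrightarrow> B $$ (i, j) = A $$ (\<sigma> i, \<sigma> j)"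
proof -
  note U = U[OF level]
  have orth: "(\<Sum>i<n. U $$ (i, j) * U $$ (i, j')) = (if j = j' then 1 else 0)" if "j < n" "j' < n" for j j'
  proof -
    have "(\<Sum>i<n. U $$ (i, j) * U $$ (i, j')) = (transpose_mat U * U) $$ (j, j')"
      using U that by (simp add: scalar_prod_def atLeast0LessThan)
    then show ?thesis
      using UT_U[OF level] that by simp
  qed
  have sum1: "(\<Sum>i<n. U $$ (i, j)) = 1" if "j < n" for j
  proof -
    have "(\<Sum>i<n. U $$ (i, j)) = (transpose_mat U *\<^sub>v krylov A e 0) $ j"
      using U that by (simp add: scalar_prod_def atLeast0LessThan e_def)
    then show ?thesis
      using that unfolding UT_krylov[OF level] by (simp add: e_def)
  qed
  have bit: "U $$ (i, j) = 0 \<or> U $$ (i, j) = 1" if "i < n" "j < n" for i j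
  proof -
    have "(\<Sum>i<n. U $$ (i, j) * U $$ (i, j) - U $$ (i, j)) = 0"
      using orth[OF that(2,2)] sum1[OF that(2)] by (simp add: sum_subtractf)
    moreover have "0 \<le> x * x - x" for x :: int
      by (cases "x \<le> 0") (auto simp: mult_le_cancel_left1 intro: order.trans[OF _ zero_le_square])
    ultimately have "U $$ (i, j) * U $$ (i, j) - U $$ (i, j) = 0"
      using that by (simp add: sum_nonneg_eq_0_iff)
    then show ?thesis
      by (simp add: algebra_simps flip: right_diff_distrib)
  qed
  have "\<exists>s<n. \<forall>i<n. U $$ (i, j) = (if i = s then 1 else 0)" if "j < n" for j
  proof -
    have "int (card {i. i < n \<and> U $$ (i, j) = 1}) = (\<Sum>i<n. if U $$ (i, j) = 1 then 1 else 0)"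
      by (simp add: sum.If_cases Int_def)
    also have "\<dots> = (\<Sum>i<n. U $$ (i, j))"
      using bit that by (intro sum.cong) auto
    finally have "card {i. i < n \<and> U $$ (i, j) = 1} = 1"
      using sum1[OF that] by simp
    then obtain s where s: "{i. i < n \<and> U $$ (i, j) = 1} = {s}"
      by (auto simp: card_1_singleton_iff)
    then have "s < n"
      by blast
    moreover have "U $$ (i, j) = (if i = s then 1 else 0)" if "i < n" for i
      using s bit[OF that \<open>j < n\<close>] that by auto
    ultimately show ?thesis
      by blast
  qed
  then obtain \<sigma> where \<sigma>: "\<And>j. j < n \<Longrightarrow> \<sigma> j < n"
    "\<And>i j. i < n \<Longrightarrow> j < n \<Longrightarrow> U $$ (i, j) = (if i = \<sigma> j then 1 else 0)"
    by metis
  have inj: "\<sigma> i = \<sigma> j \<longleftrightarrow> i = j" if "i < n" "j < n" for i j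
  proof
    assume "\<sigma> i = \<sigma> j"
    then have "(\<Sum>k<n. U $$ (k, i) * U $$ (k, j)) = (\<Sum>k<n. U $$ (k, i) * U $$ (k, i))"
      using that \<sigma>(2) by (intro sum.cong) auto
    then show "i = j"
      using orth[OF that] orth[OF that(1) that(1)] by (auto split: if_splits)
  qed simp
  have "inj_on \<sigma> {0..<n}" "\<sigma> ` {0..<n} \<subseteq> {0..<n}"
    using inj \<sigma> by (auto simp: inj_on_def)
  then have bij: "bij_betw \<sigma> {0..<n} {0..<n}"
    by (simp add: bij_betw_def endo_inj_surj)
  have "B $$ (i, j) = A $$ (\<sigma> i, \<sigma> j)" if ij: "i < n" "j < n" for i j
  proof -
    have "(B * transpose_mat U) $$ (i, \<sigma> j) = (\<Sum>k<n. B $$ (i, k) * U $$ (\<sigma> j, k))"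
      using ij \<sigma>(1) B U by (simp add: scalar_prod_def atLeast0LessThan)
    also have "\<dots> = (\<Sum>k<n. if k = j then B $$ (i, k) else 0)"
      using ij \<sigma> inj by (intro sum.cong) auto
    also have "\<dots> = B $$ (i, j)"
      using ij by simp
    finally have "B $$ (i, j) = (B * transpose_mat U) $$ (i, \<sigma> j)" ..
    also have "\<dots> = (transpose_mat U * A) $$ (i, \<sigma> j)"
      by (simp only: UT_A[OF level])
    also have "\<dots> = (\<Sum>k<n. U $$ (k, i) * A $$ (k, \<sigma> j))"
      using ij \<sigma>(1) A U by (simp add: scalar_prod_def atLeast0LessThan)
    also have "\<dots> = (\<Sum>k<n. if k = \<sigma> i then A $$ (k, \<sigma> j) else 0)"
      using ij \<sigma> by (intro sum.cong) auto
    also have "\<dots> = A $$ (\<sigma> i, \<sigma> j)"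
      using ij \<sigma>(1) by simp
    finally show ?thesis .
  qed
  with bij show ?thesis
    using that by blast
qed

end

text \<open>A monic complex polynomial is the product over its roots, and their number is its
  degree, here the size of the matrix. The embedding into the complex numbers is injective on
  integer polynomials.\<close>

lemma char_poly_eq_if_proots_eq:
  fixes A B :: "int mat"
  assumes A: "A \<in> carrier_mat n n" and B: "B \<in> carrier_mat m m"
    and eq: "proots (char_poly (map_mat complex_of_int A)) = proots (char_poly (map_mat complex_of_int B))"
  shows "n = m" and "char_poly A = char_poly B"
proof -
  let ?c = "\<lambda>M. char_poly (map_mat complex_of_int M)"
  have mon: "degree (?c A) = n" "lead_coeff (?c A) = 1" "degree (?c B) = m" "lead_coeff (?c B) = 1"
    using degree_monic_char_poly[of "map_mat complex_of_int A" n]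
      degree_monic_char_poly[of "map_mat complex_of_int B" m] A B by auto
  show "n = m"
    using size_proots_complex[of "?c A"] size_proots_complex[of "?c B"] eq mon by simp
  have "?c A = ?c B"
    using complex_poly_decompose_multiset[of "?c A"] complex_poly_decompose_multiset[of "?c B"] eq mon by simp
  then show "char_poly A = char_poly B"
    unfolding of_int_hom.char_poly_hom[OF A] of_int_hom.char_poly_hom[OF B] by simp
qed

section \<open>Adjacency matrices\<close>

lemma adjacency_mat_carrier [simp]:
  "graph_on n G \<Longrightarrow> adjacency_mat G \<in> carrier_mat n n"
  by (simp add: adjacency_mat_def graph_on_def)

lemma adjacency_mat_nth:
  assumes "graph_on n G" "i < n" "j < n"
  shows "adjacency_mat G $$ (i, j) = (if (i, j) \<in> parcs G then 1 else 0)"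
  using assms by (simp add: adjacency_mat_def graph_on_def)

lemma adjacency_mat_symmetric:
  assumes G: "graph_on n G"
  shows "transpose_mat (adjacency_mat G) = adjacency_mat G"
proof -
  interpret pair_graph G
    using G by (simp add: graph_on_def)
  have "(j, i) \<in> parcs G \<longleftrightarrow> (i, j) \<in> parcs G" for i j
    using pair_sym_arcs by (auto simp: symmetric_def elim: symE)
  then show ?thesis
    by (intro eq_matI) (auto simp: adjacency_mat_def)
qed

lemma adjacency_mat_diag:
  assumes G: "graph_on n G" and "i < n"
  shows "adjacency_mat G $$ (i, i) = 0"
proof -
  interpret pair_graph G
    using G by (simp add: graph_on_def)
  have "(i, i) \<notin> parcs G"
    using no_loops by fastforce
  then show ?thesis
    using assms by (simp add: adjacency_mat_nth)
qed

lemma adjacency_mat_of_int: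
  assumes "graph_on n G"
  shows "adjacency_mat G = map_mat of_int (adjacency_mat G :: int mat)"
  by (intro eq_matI) (auto simp: adjacency_mat_def)

lemma adjacency_mat_complement_graph:
  assumes G: "graph_on n G"
  shows "adjacency_mat (complement_graph G)
    = mat n n (\<lambda>(i, j). if i = j then 0 else 1) - (adjacency_mat G :: int mat)"
proof -
  interpret pair_graph G
    using G by (simp add: graph_on_def)
  have "(i, i) \<notin> parcs G" for i
    using no_loops by fastforce
  then show ?thesis
    using G by (intro eq_matI) (auto simp: adjacency_mat_def complement_graph_def graph_on_def)
qed

lemma walk_mat_eq_krylov_mat:
  assumes G: "graph_on n G"
  shows "walk_mat G = krylov_mat (adjacency_mat G) (vec n (\<lambda>_. 1))"
proof -
  let ?A = "adjacency_mat G :: int mat"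
  note A = adjacency_mat_carrier[OF G, where ?'a = int]
  have pow: "(?A ^\<^sub>m k) *\<^sub>v v = krylov ?A v k" if "v \<in> carrier_vec n" for k v
    using that
  proof (induction k arbitrary: v)
    case (Suc k)
    have "(?A ^\<^sub>m Suc k) *\<^sub>v v = (?A ^\<^sub>m k) *\<^sub>v (?A *\<^sub>v v)"
      using A Suc.prems by (simp add: assoc_mult_mat_vec[of _ n n _ n])
    also have "\<dots> = krylov ?A (?A *\<^sub>v v) k"
      using A Suc by simp
    finally show ?case
      by (simp add: krylov_def funpow_swap1)
  qed (use A in auto)
  have "card (pverts G) = n"
    using G by (simp add: graph_on_def)
  then show ?thesis
    using A by (intro eq_matI) (auto simp: walk_mat_def krylov_mat_def pow mat_of_cols_index)
qed

lemma generalized_spectrum_eq_walks: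
  assumes "n \<ge> 1" and G: "graph_on n G" and H: "graph_on m H"
    and spec: "generalized_spectrum H = generalized_spectrum G"
  shows "m = n" and "walks (adjacency_mat G :: int mat) k = walks (adjacency_mat H) k"
proof -
  let ?A = "adjacency_mat G :: int mat" and ?B = "adjacency_mat H :: int mat"
  let ?A' = "adjacency_mat (complement_graph G) :: int mat"
  let ?B' = "adjacency_mat (complement_graph H) :: int mat"
  note G' = graph_on_complement_graph[OF G] and H' = graph_on_complement_graph[OF H]
  have "proots (char_poly (map_mat complex_of_int ?A)) = proots (char_poly (map_mat complex_of_int ?B))"
    and "proots (char_poly (map_mat complex_of_int ?A')) = proots (char_poly (map_mat complex_of_int ?B'))"
    using spec by (auto simp: generalized_spectrum_def graph_spectrum_def
        simp flip: adjacency_mat_of_int[OF G] adjacency_mat_of_int[OF H] adjacency_mat_of_int[OF G']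
          adjacency_mat_of_int[OF H'])
  note eqs = char_poly_eq_if_proots_eq[OF adjacency_mat_carrier[OF G] adjacency_mat_carrier[OF H] this(1)]
    char_poly_eq_if_proots_eq(2)[OF adjacency_mat_carrier[OF G'] adjacency_mat_carrier[OF H'] this(2)]
  show mn: "m = n"
    using eqs(1) by simp
  have H: "graph_on n H"
    using H mn by simp
  \<comment> \<open>The spectrum of the complement enters here, through the formula for the first
    resolvent polynomial.\<close>
  have "resolvent_krylov ?A 0 = resolvent_krylov ?B 0"
    using eqs(2,3)
    by (simp add: resolvent_krylov_0_eq[OF adjacency_mat_carrier[OF G]]
        resolvent_krylov_0_eq[OF adjacency_mat_carrier[OF H]]
        flip: adjacency_mat_complement_graph[OF G] adjacency_mat_complement_graph[OF H])
  then show "walks ?A k = walks ?B k"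
    using assms(1) eqs(2) G H
    by (intro walks_eq_if_resolvent_eq[of _ n]) (auto simp: adjacency_mat_symmetric)
qed

lemma digraph_iso_if_adjacency_permuted:
  assumes G: "graph_on n G" and H: "graph_on n H" and \<sigma>: "bij_betw \<sigma> {0..<n} {0..<n}"
    and adj: "\<And>i j. i < n \<Longrightarrow> j < n \<Longrightarrow>
      adjacency_mat H $$ (i, j) = (adjacency_mat G $$ (\<sigma> i, \<sigma> j) :: int)"
  shows "digraph_iso (with_proj G) (with_proj H)"
proof -
  interpret G: pair_graph G
    using G by (simp add: graph_on_def)
  interpret H: pair_graph H
    using H by (simp add: graph_on_def)
  have verts: "pverts G = {0..<n}" "pverts H = {0..<n}"
    using G H by (auto simp: graph_on_def)
  have arcs_less: "i < n \<and> j < n" if "(i, j) \<in> parcs G \<or> (i, j) \<in> parcs H" for i j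
    using that G.in_arcsD1 G.in_arcsD2 H.in_arcsD1 H.in_arcsD2 verts by force
  have \<sigma>_less: "\<sigma> i < n" if "i < n" for i
    using \<sigma> that by (auto simp: bij_betw_def)
  have arcs: "(i, j) \<in> parcs H \<longleftrightarrow> (\<sigma> i, \<sigma> j) \<in> parcs G" if "i < n" "j < n" for i j
    using adj[OF that] that \<sigma>_less by (simp add: adjacency_mat_nth[OF G] adjacency_mat_nth[OF H] split: if_splits)
  \<comment> \<open>\<open>\<sigma>\<close> carries \<open>H\<close> to \<open>G\<close>; the
    isomorphism from \<open>G\<close> is its inverse.\<close>
  define \<tau> where "\<tau> = inv_into {0..<n} \<sigma>"
  have \<tau>: "bij_betw \<tau> {0..<n} {0..<n}"
    unfolding \<tau>_def using \<sigma> by (rule bij_betw_inv_into)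
  have \<tau>_less: "\<tau> i < n" and \<sigma>\<tau>: "\<sigma> (\<tau> i) = i" if "i < n" for i
    using \<tau> \<sigma> that by (auto simp: bij_betw_def \<tau>_def f_inv_into_f)
  have \<tau>\<sigma>: "\<tau> (\<sigma> i) = i" if "i < n" for i
    using \<sigma> that by (simp add: \<tau>_def bij_betw_inv_into_left)
  \<comment> \<open>Arcs are pairs of vertices, so the vertex map acts on them componentwise, and
    tail and head are the projections.\<close>
  define f where "f = \<lparr>iso_verts = \<tau>, iso_arcs = map_prod \<tau> \<tau>, iso_head = snd, iso_tail = fst\<rparr>"
  have "inj_on \<tau> {0..<n}"
    using \<tau> by (rule bij_betw_imp_inj_on)
  then have "inj_on (map_prod \<tau> \<tau>) ({0..<n} \<times> {0..<n})"
    by (intro map_prod_inj_on)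
  then have "inj_on (map_prod \<tau> \<tau>) (parcs G)"
    by (rule inj_on_subset) (auto dest: arcs_less[OF disjI1])
  then have "pre_digraph.digraph_isomorphism (with_proj G) f"
    unfolding pre_digraph.digraph_isomorphism_def
    using G.wf_digraph_axioms \<open>inj_on \<tau> {0..<n}\<close> by (auto simp: f_def verts)
  moreover have "map_prod \<tau> \<tau> ` parcs G = parcs H"
  proof (intro equalityI subsetI)
    fix x assume "x \<in> map_prod \<tau> \<tau> ` parcs G"
    then obtain i j where ij: "(i, j) \<in> parcs G" "x = (\<tau> i, \<tau> j)"
      by auto
    then show "x \<in> parcs H"
      using arcs_less[of i j] arcs[of "\<tau> i" "\<tau> j"] \<tau>_less \<sigma>\<tau> by simp
  next
    fix x assume "x \<in> parcs H"
    then obtain i j where ij: "(i, j) \<in> parcs H" "x = (i, j)"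
      by (cases x) auto
    then have "x = map_prod \<tau> \<tau> (\<sigma> i, \<sigma> j)" "(\<sigma> i, \<sigma> j) \<in> parcs G"
      using arcs_less[of i j] arcs[of i j] \<tau>\<sigma> by auto
    then show "x \<in> map_prod \<tau> \<tau> ` parcs G"
      by blast
  qed
  then have "with_proj H = app_iso f (with_proj G)"
    using \<tau> verts by (simp add: app_iso_def f_def with_proj_def bij_betw_def)
  ultimately show ?thesis
    unfolding digraph_iso_def by blast
qed

theorem theorem1p1:
  fixes n :: nat and G :: "nat pair_pre_digraph" and d :: int
  assumes "n \<ge> 1"
    and "graph_on n G"
    and "det (walk_mat G) \<noteq> 0"
    and "real_of_int (det (walk_mat G)) / 2 ^ (n div 2) = real_of_int d"
    and "odd d"
    and "squarefree d"
  shows "DGS G"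
  unfolding DGS_def
proof (intro allI impI, elim conjE)
  fix m H
  assume H: "graph_on m H" and spec: "generalized_spectrum H = generalized_spectrum G"
  note G = assms(2)
  note walks = generalized_spectrum_eq_walks[OF assms(1) G H spec]
  have H: "graph_on n H"
    using H walks(1) by simp
  let ?e = "vec n (\<lambda>_. 1) :: int vec"
  interpret equal_walks n "adjacency_mat G" "adjacency_mat H" ?e
    using G H walks(2) assms(3) by unfold_locales (auto simp: adjacency_mat_symmetric walk_mat_eq_krylov_mat)
  have "real_of_int (det (walk_mat G)) = real_of_int (2 ^ (n div 2) * d)"
    using assms(4) by (simp add: field_simps)
  then have "det (krylov_mat (adjacency_mat G) ?e) = 2 ^ (n div 2) * d"
    unfolding walk_mat_eq_krylov_mat[OF G] by (simp only: of_int_eq_iff)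
  then obtain U where "is_level 1 U"
    using level_one_exists adjacency_mat_diag[OF G] assms(5,6) by blast
  then obtain \<sigma> where "bij_betw \<sigma> {0..<n} {0..<n}"
    "\<And>i j. i < n \<Longrightarrow> j < n \<Longrightarrow> adjacency_mat H $$ (i, j) = (adjacency_mat G $$ (\<sigma> i, \<sigma> j) :: int)"
    using permutation_of_level_one by blast
  then show "digraph_iso (with_proj G) (with_proj H)"
    by (rule digraph_iso_if_adjacency_permuted[OF G H])
qed

end
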